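(* Let $d\geq 1$, $M\in\mathbb{N}$ with $M\geq 2$, and $p\in(M^{-\min\{3,d\}},1]$. Let $F$ be the fractal percolation on $[0,1]^d$ with parameters $M$ and $p$, with construction steps $F_n$ and parts $F_n^j$ as described in the context, let $D=\log(M^dp)/\log M$ and $r=1/M$. Then for each $k\in\{0,\ldots,d\}$ the limit $$\overline{\mathcal V}_k(F):=\lim_{n\to\infty} r^{n(D-k)}\,\mathbb{E} V_k(F_n)$$ exists and equals $$q_{d,k}+\sum_{T\subset\{1,\ldots,M^d\},\,|T|\geq 2}(-1)^{|T|-1}\sum_{n=1}^\infty r^{n(D-k)}\,\mathbb{E} V_k\Big(\bigcap_{j\in T}F_n^j\Big),$$ where $q_{d,k}:=V_k([0,1]^d)$ and all the series over $n$ converge.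
   Context: Fractal percolation: let $J=[0,1]^d$ and $F_0:=J$. Given $F_{n-1}$, a finite union of closed cubes of side length $M^{-(n-1)}$ from the standard $M$-adic grid, each such cube is divided into $M^d$ closed subcubes of side length $M^{-n}$, and each subcube is kept independently (of all other subcubes and of previous steps) with probability $p$; $F_n$ is the union of the kept subcubes. The limit set is $F=\bigcap_n F_n$. Let $J_1,\ldots,J_{M^d}$ be the $M^d$ closed subcubes of side $1/M$ of $J$ (level-1 cubes), and for $j\in\{1,\ldots,M^d\}$, $n\in\mathbb{N}$, let $F_n^j$ be the union of those level-$n$ cubes of $F_n$ that are contained in $J_j$ (empty union $=\emptyset$). $V_0,\ldots,V_d$ denote the intrinsic volumes (Minkowski functionals), additively extended to finite unions of compact convex sets (the convex ring); $V_0$ is the Euler characteristic and $V_k(\emptyset)=0$. *)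

theory Defs
  imports "HOL-Probability.Probability"
begin

definition unit_ball_vol :: "nat \<Rightarrow> real" where
  "unit_ball_vol j = pi powr (real j / 2) / Gamma (real j / 2 + 1)"

definition parallel_set :: "('a::metric_space) set \<Rightarrow> real \<Rightarrow> 'a set" where
  "parallel_set K e = {y. \<exists>x\<in>K. dist x y \<le> e}"

definition steiner_coeffs :: "('a::euclidean_space) set \<Rightarrow> (nat \<Rightarrow> real) \<Rightarrow> bool" where
  "steiner_coeffs K c \<longleftrightarrow> (\<forall>j>DIM('a). c j = 0) \<and>
     (\<forall>e>0. measure lborel (parallel_set K e) =
        (\<Sum>j\<le>DIM('a). unit_ball_vol (DIM('a) - j) * c j * e ^ (DIM('a) - j)))"

definition intrinsic_volume_convex :: "nat \<Rightarrow> ('a::euclidean_space) set \<Rightarrow> real" where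
  "intrinsic_volume_convex k K = (if K = {} then 0 else (THE c. steiner_coeffs K c) k)"

text \<open>Additive extension to the convex ring (finite unions of compact convex sets),
  via inclusion-exclusion for any representation.\<close>
definition intrinsic_volume :: "nat \<Rightarrow> ('a::euclidean_space) set \<Rightarrow> real" where
  "intrinsic_volume k A = (THE v. \<forall>\<K>. finite \<K> \<and> (\<forall>K\<in>\<K>. compact K \<and> convex K) \<and> \<Union>\<K> = A \<longrightarrow>
      v = (\<Sum>\<S>\<in>Pow \<K> - {{}}. (-1) ^ (card \<S> - 1) * intrinsic_volume_convex k (\<Inter>\<S>)))"

definition grid_cube :: "nat \<Rightarrow> nat \<Rightarrow> ('n::finite \<Rightarrow> nat) \<Rightarrow> (real^'n) set" where
  "grid_cube M n i = cbox (\<chi> l. real (i l) / real M ^ n) (\<chi> l. real (i l + 1) / real M ^ n)"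

definition grid_index :: "nat \<Rightarrow> nat \<Rightarrow> ('n::finite \<Rightarrow> nat) \<Rightarrow> bool" where
  "grid_index M n i \<longleftrightarrow> (\<forall>l. i l < M ^ n)"

definition ancestor :: "nat \<Rightarrow> nat \<Rightarrow> nat \<Rightarrow> ('n \<Rightarrow> nat) \<Rightarrow> ('n \<Rightarrow> nat)" where
  "ancestor M n m i = (\<lambda>l. i l div M ^ (n - m))"

text \<open>X m c \<omega>: the level-m cube with index c is kept (coin of that cube).
  A level-n cube belongs to F_n iff it and all its ancestors of level 1..n are kept.\<close>
definition fp_survives :: "nat \<Rightarrow> (nat \<Rightarrow> ('n \<Rightarrow> nat) \<Rightarrow> 'w \<Rightarrow> bool) \<Rightarrow> nat \<Rightarrow> ('n \<Rightarrow> nat) \<Rightarrow> 'w \<Rightarrow> bool" where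
  "fp_survives M X n i w \<longleftrightarrow> (\<forall>m\<in>{1..n}. X m (ancestor M n m i) w)"

definition fp_step :: "nat \<Rightarrow> (nat \<Rightarrow> ('n::finite \<Rightarrow> nat) \<Rightarrow> 'w \<Rightarrow> bool) \<Rightarrow> nat \<Rightarrow> 'w \<Rightarrow> (real^'n) set" where
  "fp_step M X n w = \<Union>{grid_cube M n i | i. grid_index M n i \<and> fp_survives M X n i w}"

definition fp_part :: "nat \<Rightarrow> (nat \<Rightarrow> ('n::finite \<Rightarrow> nat) \<Rightarrow> 'w \<Rightarrow> bool) \<Rightarrow> ('n \<Rightarrow> nat) \<Rightarrow> nat \<Rightarrow> 'w \<Rightarrow> (real^'n) set" where
  "fp_part M X j n w = \<Union>{grid_cube M n i | i. grid_index M n i \<and> fp_survives M X n i w \<and>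
       grid_cube M n i \<subseteq> grid_cube M 1 j}"

end

theory Submission
  imports Defs
begin

text \<open>The Steiner formula holds for polyhedra, because the
  points projecting to the relative interior of a fixed face form an orthogonal product, and it passes
  to compact convex sets by outer approximation. A linear relation between indicators of compact convex
  sets holds between their Euler characteristics (Hadwiger), hence after intersecting with balls and
  integrating also between their intrinsic volumes (Groemer), so that the additive extension is well
  defined and can be computed from any representation of an indicator.

  By inclusion-exclusion over the surviving cubes, all expectations are then finite sums over sets \<open>S\<close> of
  level-\<open>n\<close> cubes of \<open>(-1)^|S| V_k(\<Inter>S) p^c(S)\<close>, where \<open>c(S)\<close> is the number of coins on which the survival
  of \<open>S\<close> depends. Sorting the sets \<open>S\<close> by the set \<open>T\<close> of level-1 cubes which they meet gives the recursion
  \<open>u (n + 1) = u n + (terms with |T| \<ge> 2)\<close> for the rescaled expectations \<open>u n\<close>: the terms with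
  \<open>|T| = 1\<close> reproduce \<open>u n\<close> by self-similarity. If \<open>|T| \<ge> 2\<close> and \<open>\<Inter>S\<close> is nonempty, then \<open>S\<close> lies near a face
  of a level-1 cube, which leaves \<open>O(M^(n(d-1)))\<close> possibilities, and \<open>c(S) \<ge> 2n\<close>. So the terms decay like
  \<open>(p/M)^n\<close>.\<close>

section \<open>Euler characteristic\<close>

lemma finite_real_gap:
  fixes Z :: "real set"
  assumes "finite Z"
  obtains \<delta> where "\<delta> > 0" "\<And>x y. x \<in> Z \<Longrightarrow> y \<in> Z \<Longrightarrow> x < y \<Longrightarrow> x + \<delta> < y"
proof -
  \<comment> \<open>The element \<open>1\<close> keeps \<open>E\<close> nonempty, so that
    \<open>Min E\<close> is meaningful even if \<open>Z\<close> has fewer than two points.\<close>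
  define E where "E = insert 1 {y - x | x y. x \<in> Z \<and> y \<in> Z \<and> x < y}"
  have "finite {y - x | x y. x \<in> Z \<and> y \<in> Z \<and> x < y}"
    by (rule finite_subset[of _ "(\<lambda>(x, y). y - x) ` (Z \<times> Z)"]) (use assms in auto)
  then have fin: "finite E" by (simp add: E_def)
  have pos: "Min E > 0"
    using fin by (subst Min_gr_iff) (auto simp: E_def)
  show ?thesis
  proof (rule that[of "Min E / 2"])
    show "Min E / 2 > 0" using pos by simp
    fix x y assume "x \<in> Z" "y \<in> Z" "x < y"
    then have "Min E \<le> y - x" using fin by (intro Min_le) (auto simp: E_def)
    then show "x + Min E / 2 < y" using pos by simp
  qed
qed

text \<open>The coefficient of an interval is recovered from the jump of its indicator just after the right
  endpoint.\<close>
lemma sum_coeffs_intervals_eq_0: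
  fixes a \<alpha> \<beta> :: "'i \<Rightarrow> real"
  assumes fin: "finite I" and le: "\<And>i. i \<in> I \<Longrightarrow> \<alpha> i \<le> \<beta> i"
    and zero: "\<And>t. (\<Sum>i\<in>I. a i * indicator {\<alpha> i..\<beta> i} t) = 0"
  shows "(\<Sum>i\<in>I. a i) = 0"
proof -
  obtain \<delta> where \<delta>: "\<delta> > 0"
    "\<And>x y. x \<in> \<alpha> ` I \<union> \<beta> ` I \<Longrightarrow> y \<in> \<alpha> ` I \<union> \<beta> ` I \<Longrightarrow> x < y \<Longrightarrow> x + \<delta> < y"
    using finite_real_gap[of "\<alpha> ` I \<union> \<beta> ` I"] fin by auto
  \<comment> \<open>No endpoint lies strictly above \<open>t\<close> and at most at
    \<open>t + \<delta>\<close>. The step therefore leaves exactly the intervals that end at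
    \<open>t\<close> and enters no new one.\<close>
  have jump: "indicator {\<alpha> i..\<beta> i} t - indicator {\<alpha> i..\<beta> i} (t + \<delta>) = (if t = \<beta> i then 1 else (0::real))"
    if "i \<in> I" "t \<in> \<beta> ` I" for i t
  proof -
    have "t < \<alpha> i \<Longrightarrow> t + \<delta> < \<alpha> i" "t < \<beta> i \<Longrightarrow> t + \<delta> < \<beta> i"
      using \<delta>(2) that by auto
    then show ?thesis using \<delta>(1) le[OF that(1)]
      by (cases "t < \<alpha> i"; cases "t < \<beta> i") (auto simp: indicator_def)
  qed
  have "(\<Sum>i\<in>I. a i) = (\<Sum>i\<in>I. \<Sum>t\<in>\<beta> ` I. a i * (if t = \<beta> i then 1 else 0))"
    using fin by (intro sum.cong refl) (simp add: if_distrib cong: if_cong)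
  also have "\<dots> = (\<Sum>i\<in>I. \<Sum>t\<in>\<beta> ` I. a i * (indicator {\<alpha> i..\<beta> i} t - indicator {\<alpha> i..\<beta> i} (t + \<delta>)))"
    using jump by (intro sum.cong refl) auto
  also have "\<dots> = (\<Sum>t\<in>\<beta> ` I. (\<Sum>i\<in>I. a i * indicator {\<alpha> i..\<beta> i} t) - (\<Sum>i\<in>I. a i * indicator {\<alpha> i..\<beta> i} (t + \<delta>)))"
    by (subst sum.swap) (simp add: right_diff_distrib sum_subtractf)
  also have "\<dots> = 0" by (simp only: zero) simp
  finally show ?thesis .
qed

text \<open>Hadwiger's induction on the dimension: slice by the hyperplanes orthogonal to a basis vector.\<close>
lemma euler_characteristic_eq_0_aux:
  fixes K :: "'i \<Rightarrow> 'a::euclidean_space set" and a :: "'i \<Rightarrow> real"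
  assumes "finite B" "B \<subseteq> Basis" "finite I"
    and "\<And>i. i \<in> I \<Longrightarrow> compact (K i) \<and> convex (K i)"
    and "\<And>i x b. i \<in> I \<Longrightarrow> x \<in> K i \<Longrightarrow> b \<in> Basis - B \<Longrightarrow> x \<bullet> b = c b"
    and "\<And>x. (\<Sum>i\<in>I. a i * indicator (K i) x) = 0"
  shows "(\<Sum>i\<in>I. a i * of_bool (K i \<noteq> {})) = 0"
  using assms
proof (induction B arbitrary: K c rule: finite_induct)
  case empty
  \<comment> \<open>With no free direction left, \<open>c\<close> prescribes all coordinates, so
    every \<open>K i\<close> is contained in the single point \<open>x0\<close>.\<close>
  define x0 where "x0 = (\<Sum>b\<in>Basis. c b *\<^sub>R b)"
  have "x = x0" if "i \<in> I" "x \<in> K i" for i x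
    using empty(4)[OF that] by (auto simp: x0_def euclidean_eq_iff[of x])
  then have "of_bool (K i \<noteq> {}) = (indicator (K i) x0 :: real)" if "i \<in> I" for i
    using that by (auto simp: indicator_def)
  then have "(\<Sum>i\<in>I. a i * of_bool (K i \<noteq> {})) = (\<Sum>i\<in>I. a i * indicator (K i) x0)"
    by (intro sum.cong) auto
  then show ?case using empty by simp
next
  case (insert u B)
  have cc: "compact (K i)" "convex (K i)" if "i \<in> I" for i using insert.prems(3)[OF that] by auto
  \<comment> \<open>In the hyperplane the coordinate along \<open>u\<close> is prescribed as well,
    so the induction hypothesis applies with \<open>c(u := t)\<close>.\<close>
  have slice: "(\<Sum>i\<in>I. a i * of_bool (K i \<inter> {x. x \<bullet> u = t} \<noteq> {})) = 0" for t
  proof (rule insert.IH)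
    show "B \<subseteq> Basis" "finite I" using insert.prems by auto
    fix i assume i: "i \<in> I"
    have "compact (K i \<inter> {x. u \<bullet> x = t})" "convex (K i \<inter> {x. u \<bullet> x = t})"
      using cc[OF i] by (auto intro!: compact_Int_closed closed_hyperplane convex_Int convex_hyperplane)
    then show "compact (K i \<inter> {x. x \<bullet> u = t}) \<and> convex (K i \<inter> {x. x \<bullet> u = t})"
      by (simp add: inner_commute)
    show "x \<bullet> b = (c(u := t)) b" if "x \<in> K i \<inter> {x. x \<bullet> u = t}" "b \<in> Basis - B" for x b
      using insert.prems(4)[OF i, of x b] that by auto
  next
    fix x
    have "(\<Sum>i\<in>I. a i * indicator (K i \<inter> {x. x \<bullet> u = t}) x)
        = (\<Sum>i\<in>I. a i * indicator (K i) x) * indicator {x. x \<bullet> u = t} x"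
      by (simp add: sum_distrib_right indicator_inter_arith mult.assoc)
    then show "(\<Sum>i\<in>I. a i * indicator (K i \<inter> {x. x \<bullet> u = t}) x) = 0"
      using insert.prems(5)[of x] by simp
  qed
  \<comment> \<open>Empty sets are dropped because their projection is no interval with
    \<open>\<alpha> i \<le> \<beta> i\<close>.\<close>
  define J where "J = {i\<in>I. K i \<noteq> {}}"
  have "\<exists>\<alpha> \<beta>. (\<lambda>x. x \<bullet> u) ` K i = {\<alpha>..\<beta>}" if "i \<in> I" for i
  proof -
    have "continuous_on (K i) (\<lambda>x. x \<bullet> u)" by (intro continuous_intros)
    then have "compact ((\<lambda>x. x \<bullet> u) ` K i)" "connected ((\<lambda>x. x \<bullet> u) ` K i)"
      using cc[OF that] by (auto intro: compact_continuous_image connected_continuous_image convex_connected)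
    then show ?thesis using connected_compact_interval_1 by blast
  qed
  then obtain \<alpha> \<beta> where im: "\<And>i. i \<in> I \<Longrightarrow> (\<lambda>x. x \<bullet> u) ` K i = {\<alpha> i..\<beta> i}" by metis
  have "(\<Sum>i\<in>J. a i) = 0"
  proof (rule sum_coeffs_intervals_eq_0)
    show "finite J" using insert.prems by (simp add: J_def)
    show "\<alpha> i \<le> \<beta> i" if "i \<in> J" for i
      using that im[of i] by (fastforce simp: J_def)
    fix t
    \<comment> \<open>A slice is nonempty exactly when \<open>t\<close> lies in the projection of
      \<open>K i\<close>, so the slice sums form a relation between indicators of intervals.\<close>
    have "of_bool (K i \<inter> {x. x \<bullet> u = t} \<noteq> {}) = (indicator {\<alpha> i..\<beta> i} t :: real)" if "i \<in> I" for i
      using im[OF that, symmetric] by (auto simp: indicator_def)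
    then have "(\<Sum>i\<in>I. a i * indicator {\<alpha> i..\<beta> i} t) = 0"
      using slice[of t] by simp
    moreover have "(\<Sum>i\<in>J. a i * indicator {\<alpha> i..\<beta> i} t) = (\<Sum>i\<in>I. a i * indicator {\<alpha> i..\<beta> i} t)"
      using insert.prems im by (intro sum.mono_neutral_left) (force simp: J_def indicator_def)+
    ultimately show "(\<Sum>i\<in>J. a i * indicator {\<alpha> i..\<beta> i} t) = 0" by simp
  qed
  moreover have "(\<Sum>i\<in>I. a i * of_bool (K i \<noteq> {})) = (\<Sum>i\<in>J. a i)"
    unfolding J_def using insert.prems(2) by (simp add: sum.inter_filter of_bool_def if_distrib cong: if_cong)
  ultimately show ?case by simp
qed

lemma euler_characteristic_eq_0:
  fixes K :: "'i \<Rightarrow> 'a::euclidean_space set" and a :: "'i \<Rightarrow> real"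
  assumes "finite I" "\<And>i. i \<in> I \<Longrightarrow> compact (K i)" "\<And>i. i \<in> I \<Longrightarrow> convex (K i)"
    and "\<And>x. (\<Sum>i\<in>I. a i * indicator (K i) x) = 0"
  shows "(\<Sum>i\<in>I. a i * of_bool (K i \<noteq> {})) = 0"
  by (rule euler_characteristic_eq_0_aux[of Basis, where c = "\<lambda>_. 0"]) (use assms in auto)

section \<open>Steiner formula\<close>

text \<open>The change of variables theorems of \<^theory>\<open>HOL-Analysis.Change_Of_Vars\<close> assume a well-ordered index
  type. Here the index type is only finite, and the existence of some scaling factor suffices: for an
  orthogonal map the unit ball shows that it is \<open>1\<close>.\<close>
lemma linear_image_measure_factor:
  fixes f :: "real^'n \<Rightarrow> real^'n"
  assumes "linear f"
  obtains m where "\<And>S. S \<in> lmeasurable \<Longrightarrow> f ` S \<in> lmeasurable \<and> measure lebesgue (f ` S) = m * measure lebesgue S"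
proof -
  define Q :: "(real^'n \<Rightarrow> real^'n) \<Rightarrow> bool" where
    "Q f \<longleftrightarrow> (\<exists>m. \<forall>S\<in>lmeasurable. f ` S \<in> lmeasurable \<and> measure lebesgue (f ` S) = m * measure lebesgue S)" for f
  \<comment> \<open>Serves the swaps and shears: a linear map that preserves the volume of boxes has
    factor \<open>1\<close> on all measurable sets.\<close>
  have box: "Q f" if "linear f" "\<And>a b. measure lebesgue (f ` cbox a b) = measure lebesgue (cbox a b)" for f
    unfolding Q_def
  proof (intro exI[of _ 1] ballI)
    fix S :: "(real^'n) set" assume "S \<in> lmeasurable"
    have "f ` S \<in> lmeasurable \<and> 1 * measure lebesgue S = measure lebesgue (f ` S)"
      by (rule measure_linear_sufficient[OF that(1) \<open>S \<in> lmeasurable\<close>]) (simp add: that(2))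
    then show "f ` S \<in> lmeasurable \<and> measure lebesgue (f ` S) = 1 * measure lebesgue S" by simp
  qed
  have "Q f"
  proof (rule induct_linear_elementary[OF assms])
    fix f g assume "Q f" "Q g"
    then obtain m k where "\<forall>S\<in>lmeasurable. f ` S \<in> lmeasurable \<and> measure lebesgue (f ` S) = m * measure lebesgue S"
      "\<forall>S\<in>lmeasurable. g ` S \<in> lmeasurable \<and> measure lebesgue (g ` S) = k * measure lebesgue S"
      by (auto simp: Q_def)
    then show "Q (f \<circ> g)"
      unfolding Q_def image_comp[symmetric] by (intro exI[of _ "m * k"]) simp
  next
    fix f :: "real^'n \<Rightarrow> real^'n" and i :: 'n assume f: "linear f" "\<And>x. f x $ i = (0::real)"
    have "negligible (f ` S)" for S
    proof (rule negligible_subset)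
      show "negligible {x::real^'n. axis i 1 \<bullet> x = 0}"
        by (rule negligible_hyperplane) auto
      show "f ` S \<subseteq> {x. axis i 1 \<bullet> x = 0}" using f(2) by (auto simp: inner_axis')
    qed
    then show "Q f"
      unfolding Q_def
      by (intro exI[of _ 0]) (simp add: negligible_imp_measurable negligible_imp_measure0)
  next
    show "Q (\<lambda>x. \<chi> i. c i * x $ i)" for c
      unfolding Q_def
      by (intro exI[of _ "\<bar>prod c UNIV\<bar>"] ballI conjI measurable_stretch measure_stretch)
  next
    fix m n :: 'n assume "m \<noteq> n"
    let ?h = "\<lambda>v::real^'n. \<chi> i. v $ Transposition.transpose m n i"
    show "Q ?h"
    proof (rule box)
      show "linear ?h" by (rule linearI) (simp_all add: plus_vec_def scaleR_vec_def)
      fix a b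
      have eq: "?h ` cbox a b = cbox (?h a) (?h b)"
      proof (intro set_eqI iffI)
        fix y assume "y \<in> cbox (?h a) (?h b)"
        then have "?h y \<in> cbox a b" by (auto simp: mem_box_cart) (metis transpose_involutory)+
        then show "y \<in> ?h ` cbox a b" by (intro image_eqI[of _ _ "?h y"]) (auto simp: vec_eq_iff)
      qed (auto simp: mem_box_cart)
      show "measure lebesgue (?h ` cbox a b) = measure lebesgue (cbox a b)"
      proof (cases "cbox a b = {}")
        case False
        then have "cbox (?h a) (?h b) \<noteq> {}" using eq by auto
        then show ?thesis using False
          using prod.permute [OF permutes_swap_id, where S=UNIV and g="\<lambda>i. (b - a)$i", symmetric, of m n]
          by (simp add: eq content_cbox_cart)
      qed simp
    qed
  next
    fix m n :: 'n assume mn: "m \<noteq> n"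
    let ?h = "\<lambda>v::real^'n. \<chi> i. if i = m then v $ m + v $ n else v $ i"
    show "Q ?h"
    proof (rule box)
      show lin: "linear ?h" by (rule linearI) (auto simp: algebra_simps vec_eq_iff)
      fix a b :: "real^'n"
      show "measure lebesgue (?h ` cbox a b) = measure lebesgue (cbox a b)"
      proof (cases "cbox a b = {}")
        case False
        \<comment> \<open>Moving the lower corner of the box to \<open>0\<close> secures the sign
          condition of \<open>measure_shear_interval\<close>.\<close>
        let ?v = "- a"
        have "?h ` cbox (?v + a) (?v + b) = (+) (?h ?v) ` ?h ` cbox a b"
          unfolding cbox_translation image_comp using linear_add[OF lin, of ?v]
          by (intro image_cong refl) simp
        then have "measure lebesgue (?h ` cbox a b) = measure lebesgue (?h ` cbox (?v + a) (?v + b))"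
          by (simp only: measure_translation)
        also have "\<dots> = measure lebesgue (cbox (?v + a) (?v + b))"
        proof (rule measure_shear_interval[OF mn])
          show "cbox (?v + a) (?v + b) \<noteq> {}"
            using False by (simp only: cbox_translation image_is_empty not_False_eq_True)
        qed simp
        also have "\<dots> = measure lebesgue (cbox a b)"
          by (simp only: cbox_translation measure_translation)
        finally show ?thesis .
      qed simp
    qed
  qed
  then show ?thesis using that unfolding Q_def by metis
qed

lemma lmeasurable_orthogonal_image:
  fixes f :: "real^'n \<Rightarrow> real^'n"
  assumes "orthogonal_transformation f" "S \<in> lmeasurable"
  shows "f ` S \<in> lmeasurable" "measure lebesgue (f ` S) = measure lebesgue S"
proof -
  obtain m where m: "\<And>S. S \<in> lmeasurable \<Longrightarrow> f ` S \<in> lmeasurable \<and> measure lebesgue (f ` S) = m * measure lebesgue S"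
    using linear_image_measure_factor orthogonal_transformation_linear[OF assms(1)] by metis
  have "f ` ball 0 1 = ball 0 1"
    using image_orthogonal_transformation_ball[OF assms(1), of 0 1]
      linear_0[OF orthogonal_transformation_linear[OF assms(1)]] by simp
  then have "measure lebesgue (ball (0::real^'n) 1) = m * measure lebesgue (ball (0::real^'n) 1)"
    using m[of "ball 0 1"] by simp
  moreover have "measure lebesgue (ball (0::real^'n) 1) > 0" by (simp add: content_ball_pos)
  ultimately have "m = 1" by simp
  then show "f ` S \<in> lmeasurable" "measure lebesgue (f ` S) = measure lebesgue S"
    using m assms(2) by auto
qed

text \<open>Multiplies the component along each vector of \<open>B\<close> by \<open>t\<close>, when \<open>B\<close> is orthonormal.\<close>
definition stretch_along :: "real \<Rightarrow> 'a::real_inner set \<Rightarrow> 'a \<Rightarrow> 'a" where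
  "stretch_along t B x = x + (t - 1) *\<^sub>R (\<Sum>u\<in>B. (x \<bullet> u) *\<^sub>R u)"

text \<open>An orthogonal map that sends a coordinate axis to \<open>u\<close> conjugates the
  stretching of that coordinate into the stretching along \<open>u\<close>.\<close>

lemma measure_stretch_along_unit:
  fixes u :: "real^'n"
  assumes "norm u = 1" "t \<ge> 0" "S \<in> lmeasurable"
  shows "stretch_along t {u} ` S \<in> lmeasurable"
    "measure lebesgue (stretch_along t {u} ` S) = t * measure lebesgue S"
proof -
  obtain k :: 'n where True by auto
  obtain f :: "real^'n \<Rightarrow> real^'n" where f: "orthogonal_transformation f" "f (axis k 1) = u"
    by (rule orthogonal_transformation_exists_1[of "axis k 1" u]) (use assms(1) in auto)
  define g where "g = inv f"
  have g: "orthogonal_transformation g" "\<And>x. f (g x) = x"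
    using orthogonal_transformation_inv[OF f(1)] orthogonal_transformation_surj[OF f(1)]
    by (auto simp: g_def surj_f_inv_f)
  let ?D = "\<lambda>x::real^'n. \<chi> i. (if i = k then t else 1) * x $ i"
  have "f (?D (g x)) = stretch_along t {u} x" for x
  proof -
    have "?D y = y + ((t - 1) * (y \<bullet> axis k 1)) *\<^sub>R axis k 1" for y
      by (simp add: vec_eq_iff inner_axis) (simp add: axis_def algebra_simps)
    then have "f (?D (g x)) = f (g x) + ((t - 1) * (g x \<bullet> axis k 1)) *\<^sub>R f (axis k 1)"
      using orthogonal_transformation_linear[OF f(1)] by (simp add: linear_add linear_scale)
    moreover have "g x \<bullet> axis k 1 = x \<bullet> u"
      using f g(2)[of x] by (metis orthogonal_transformation_def)
    ultimately show ?thesis using f(2) g(2) by (simp add: stretch_along_def)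
  qed
  then have eq: "stretch_along t {u} ` S = f ` ?D ` g ` S" by (auto simp: image_image)
  note 1 = lmeasurable_orthogonal_image[OF g(1) assms(3)]
  note 2 = measurable_stretch[OF 1(1), of "\<lambda>i. if i = k then t else 1"]
    measure_stretch[OF 1(1), of "\<lambda>i. if i = k then t else 1"]
  note 3 = lmeasurable_orthogonal_image[OF f(1) 2(1)]
  show "stretch_along t {u} ` S \<in> lmeasurable" using 3 eq by simp
  show "measure lebesgue (stretch_along t {u} ` S) = t * measure lebesgue S"
    using 1 2 3 eq assms(2) by (simp add: prod.delta)
qed

text \<open>The stretch along \<open>B\<close> leaves the component along a further orthogonal
  vector \<open>u\<close> unchanged. So the stretches compose, and each vector contributes one
  factor \<open>t\<close>.\<close>

lemma measure_stretch_along: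
  fixes B :: "(real^'n) set"
  assumes "finite B" "pairwise orthogonal B" "\<And>u. u \<in> B \<Longrightarrow> norm u = 1" "t \<ge> 0" "S \<in> lmeasurable"
  shows "stretch_along t B ` S \<in> lmeasurable \<and>
    measure lebesgue (stretch_along t B ` S) = t ^ card B * measure lebesgue S"
  using assms
proof (induction B rule: finite_induct)
  case empty
  then show ?case by (simp add: stretch_along_def)
next
  case (insert u B)
  have IH: "stretch_along t B ` S \<in> lmeasurable"
    "measure lebesgue (stretch_along t B ` S) = t ^ card B * measure lebesgue S"
    using insert by (auto simp: pairwise_insert)
  have "stretch_along t B x \<bullet> u = x \<bullet> u" for x
  proof -
    have "v \<bullet> u = 0" if "v \<in> B" for v
      using insert.prems(1) insert.hyps(2) that unfolding pairwise_insert orthogonal_def by metis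
    then have "(\<Sum>v\<in>B. (x \<bullet> v) *\<^sub>R v) \<bullet> u = 0" by (simp add: inner_sum_left)
    then show ?thesis by (simp add: stretch_along_def inner_add_left)
  qed
  then have "stretch_along t {u} (stretch_along t B x) = stretch_along t B x + (t - 1) *\<^sub>R (x \<bullet> u) *\<^sub>R u" for x
    by (simp add: stretch_along_def[of t "{u}"])
  then have "stretch_along t (insert u B) x = stretch_along t {u} (stretch_along t B x)" for x
    using insert.hyps by (simp only:) (simp add: stretch_along_def scaleR_add_right)
  then have "stretch_along t (insert u B) ` S = stretch_along t {u} ` stretch_along t B ` S"
    by (auto simp: image_image)
  then show ?case
    using measure_stretch_along_unit[of u t "stretch_along t B ` S"] IH insert by simp
qed

section \<open>Parallel sets and nearest-point projection\<close>

text \<open>As a Minkowski sum with a ball, a parallel set inherits compactness and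
  convexity.\<close>

lemma parallel_set_eq_sums: "parallel_set K e = (\<Union>x\<in>K. \<Union>y\<in>cball 0 e. {x + y})"
  for K :: "'a::real_normed_vector set"
proof (intro set_eqI iffI)
  fix z assume "z \<in> parallel_set K e"
  then obtain x where "x \<in> K" "dist x z \<le> e" by (auto simp: parallel_set_def)
  then have "z - x \<in> cball 0 e" "z = x + (z - x)" by (auto simp: dist_norm norm_minus_commute)
  then show "z \<in> (\<Union>x\<in>K. \<Union>y\<in>cball 0 e. {x + y})" using \<open>x \<in> K\<close> by blast
next
  fix z assume "z \<in> (\<Union>x\<in>K. \<Union>y\<in>cball 0 e. {x + y})"
  then show "z \<in> parallel_set K e" by (force simp: parallel_set_def dist_norm)
qed

text \<open>This turns the Euler characteristic of an intersection with a ball into the indicator of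
  a parallel set.\<close>

lemma parallel_set_Int_cball: "y \<in> parallel_set K e \<longleftrightarrow> K \<inter> cball y e \<noteq> {}"
  by (auto simp: parallel_set_def dist_commute)

lemma compact_parallel_set: "compact K \<Longrightarrow> compact (parallel_set K e)" for K :: "'a::euclidean_space set"
  unfolding parallel_set_eq_sums by (rule compact_sums') auto

lemma convex_parallel_set: "convex K \<Longrightarrow> convex (parallel_set K e)" for K :: "'a::euclidean_space set"
  unfolding parallel_set_eq_sums by (rule convex_sums) auto

text \<open>The vector \<open>v\<close> is an outer normal of \<open>P\<close> at \<open>x\<close>.
  Expanding the square of \<open>norm (v - (z - x))\<close> shows that no \<open>z\<close> in
  \<open>P\<close> is closer to \<open>x + v\<close> than \<open>x\<close>.\<close>

lemma closest_point_normal: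
  fixes P :: "'a::euclidean_space set"
  assumes "convex P" "closed P" "x \<in> P" "\<And>z. z \<in> P \<Longrightarrow> v \<bullet> (z - x) \<le> 0"
  shows "closest_point P (x + v) = x"
proof (rule closest_point_unique[OF assms(1-3), symmetric], rule ballI)
  fix z assume "z \<in> P"
  have "norm v ^ 2 \<le> norm v ^ 2 - 2 * (v \<bullet> (z - x)) + norm (z - x) ^ 2"
    using assms(4)[OF \<open>z \<in> P\<close>] by (simp add: add_increasing2)
  also have "\<dots> = norm (v - (z - x)) ^ 2"
    by (simp add: power2_norm_eq_inner inner_diff inner_commute)
  finally have "norm v \<le> norm (v - (z - x))" by (simp add: power2_le_iff_abs_le)
  then show "dist (x + v) x \<le> dist (x + v) z" by (simp add: dist_norm algebra_simps)
qed

lemma stretch_along_orthogonal_complement: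
  assumes "\<And>w. w \<in> B \<Longrightarrow> x \<bullet> w = 0"
  shows "stretch_along t B x = x"
  using assms by (simp add: stretch_along_def)

lemma stretch_along_span:
  fixes B :: "'a::euclidean_space set"
  assumes "finite B" "pairwise orthogonal B" "\<And>u. u \<in> B \<Longrightarrow> norm u = 1" "x \<in> span B"
  shows "stretch_along t B x = t *\<^sub>R x"
  using orthonormal_basis_expand[OF assms(2,3,4,1)] by (simp add: stretch_along_def algebra_simps)

lemma stretch_along_add: "stretch_along t B (x + y) = stretch_along t B x + stretch_along t B y"
  by (simp add: stretch_along_def algebra_simps sum.distrib)

text \<open>The points projecting to the relative interior \<open>F\<close> of a face form the orthogonal product of \<open>F\<close>
  with its normal cone, so the part within distance \<open>e\<close> arises from the part within distance \<open>1\<close> by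
  stretching the normal directions.\<close>
lemma measure_normal_cell:
  fixes P F :: "(real^'n) set"
  assumes P: "convex P" "closed P" and F: "F \<subseteq> P" "F \<noteq> {}" and W: "subspace W"
    and FW: "\<And>x y w. x \<in> F \<Longrightarrow> y \<in> F \<Longrightarrow> w \<in> W \<Longrightarrow> (x - y) \<bullet> w = 0"
    and NW: "\<And>x v. x \<in> F \<Longrightarrow> (\<And>z. z \<in> P \<Longrightarrow> v \<bullet> (z - x) \<le> 0) \<Longrightarrow> v \<in> W"
    and meas: "{y. closest_point P y \<in> F \<and> dist (closest_point P y) y \<le> 1} \<in> lmeasurable"
    and "e > 0"
  shows "measure lebesgue {y. closest_point P y \<in> F \<and> dist (closest_point P y) y \<le> e}
       = e ^ dim W * measure lebesgue {y. closest_point P y \<in> F \<and> dist (closest_point P y) y \<le> 1}"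
proof -
  define A where "A e = {y. closest_point P y \<in> F \<and> dist (closest_point P y) y \<le> e}" for e
  obtain B where B: "B \<subseteq> W" "pairwise orthogonal B" "\<And>x. x \<in> B \<Longrightarrow> norm x = 1"
    "independent B" "card B = dim W" "span B = W"
    using orthonormal_basis_subspace[OF W] by metis
  have finB: "finite B" using B(4) by (rule independent_imp_finite)
  obtain x0 where x0: "x0 \<in> F" using F(2) by auto
  define L where "L t y = x0 + stretch_along t B (y - x0)" for t y
  \<comment> \<open>The vector \<open>y - closest_point P y\<close> lies in \<open>W\<close>, while
    \<open>closest_point P y - x0\<close> is orthogonal to \<open>W\<close>. So \<open>L t\<close>
    slides \<open>y\<close> along its normal ray and keeps its projection.\<close>
  have nor: "L t y = closest_point P y + t *\<^sub>R (y - closest_point P y)"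
    "closest_point P (L t y) = closest_point P y"
    if "closest_point P y \<in> F" "t > 0" for t y
  proof -
    define x where "x = closest_point P y"
    have xF: "x \<in> F" using that by (simp add: x_def)
    have v: "(y - x) \<bullet> (z - x) \<le> 0" if "z \<in> P" for z
      using closest_point_dot[OF P that] by (simp add: x_def)
    have "y - x \<in> span B" using NW[OF xF v] B(6) by simp
    moreover have "(x - x0) \<bullet> w = 0" if "w \<in> B" for w using FW[OF xF x0] B(1) that by auto
    ultimately have "stretch_along t B ((x - x0) + (y - x)) = (x - x0) + t *\<^sub>R (y - x)"
      unfolding stretch_along_add
      using stretch_along_span[OF finB B(2,3), of "y - x"] stretch_along_orthogonal_complement[of B "x - x0"]
      by simp
    then show 1: "L t y = closest_point P y + t *\<^sub>R (y - closest_point P y)"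
      by (simp add: L_def x_def)
    have "(t *\<^sub>R (y - x)) \<bullet> (z - x) \<le> 0" if "z \<in> P" for z
      using v[OF that] \<open>t > 0\<close> by (simp add: mult_nonneg_nonpos)
    then show "closest_point P (L t y) = closest_point P y"
      using closest_point_normal[OF P, of x "t *\<^sub>R (y - x)"] xF F(1) by (auto simp: 1 x_def)
  qed
  have sub: "L t y \<in> A (t * s)" if "y \<in> A s" "t > 0" for s t y
  proof -
    have y: "closest_point P y \<in> F" "dist (closest_point P y) y \<le> s" using that(1) by (auto simp: A_def)
    have "dist (closest_point P y) (L t y) = t * dist (closest_point P y) y"
      using nor(1)[OF y(1) that(2)] that(2) by (simp add: dist_norm norm_minus_commute)
    then show ?thesis using y that(2) nor(2)[OF y(1) that(2)] by (simp add: A_def)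
  qed
  have "A e = L e ` A 1"
  proof (intro equalityI subsetI)
    fix y assume y: "y \<in> A e"
    have yF: "closest_point P y \<in> F" using y by (simp add: A_def)
    have 1: "L (1 / e) y \<in> A 1" using sub[OF y, of "1 / e"] \<open>e > 0\<close> by simp
    have "L e (L (1 / e) y) = y"
      using nor[OF yF, of "1 / e"] nor(1)[of "L (1 / e) y" e] yF \<open>e > 0\<close> by simp
    then show "y \<in> L e ` A 1" using 1 by (metis image_eqI)
  qed (use sub[of _ 1 e] \<open>e > 0\<close> in auto)
  also have "\<dots> = (+) x0 ` stretch_along e B ` (+) (- x0) ` A 1"
    by (auto simp: L_def image_image)
  finally have eq: "A e = (+) x0 ` stretch_along e B ` (+) (- x0) ` A 1" .
  have "measure lebesgue (A e) = measure lebesgue (stretch_along e B ` (+) (- x0) ` A 1)"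
    unfolding eq by (rule measure_translation)
  also have "\<dots> = e ^ card B * measure lebesgue ((+) (- x0) ` A 1)"
    using measure_stretch_along[OF finB B(2,3), of e "(+) (- x0) ` A 1"] \<open>e > 0\<close>
      measurable_translation[of "A 1" "- x0"] meas by (simp add: A_def)
  also have "\<dots> = e ^ dim W * measure lebesgue (A 1)"
    by (simp only: measure_translation B(5))
  finally show ?thesis by (simp add: A_def)
qed

text \<open>The points of \<open>P\<close> are sorted by the set of constraints that are tight
  there. The projection pulls this back to a partition of the parallel set, and
  \<open>measure_normal_cell\<close> makes the volume of each cell a monomial in
  \<open>e\<close>.\<close>

lemma steiner_polyhedron:
  fixes P :: "(real^'n) set"
  assumes "polyhedron P" "bounded P" "P \<noteq> {}"
  obtains p where "degree p \<le> CARD('n)" "\<And>e. e > 0 \<Longrightarrow> measure lebesgue (parallel_set P e) = poly p e"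
proof -
  obtain H where H: "finite H" "P = \<Inter>H" "\<forall>h\<in>H. \<exists>a b. a \<noteq> 0 \<and> h = {x. a \<bullet> x \<le> b}"
    using assms(1) unfolding polyhedron_def by auto
  then obtain a b where ab: "\<And>h. h \<in> H \<Longrightarrow> h = {x. a h \<bullet> x \<le> b h}" by metis
  have Pmem: "x \<in> P \<longleftrightarrow> (\<forall>h\<in>H. a h \<bullet> x \<le> b h)" for x using H(2) ab by blast
  have P: "convex P" "closed P" "compact P"
    using assms polyhedron_imp_convex polyhedron_imp_closed compact_eq_bounded_closed by blast+
  \<comment> \<open>If nonempty, \<open>F I\<close> is the relative interior of a face;
    \<open>W I\<close> is spanned by the normals of its tight constraints.\<close>
  define F where "F I = {x\<in>P. \<forall>h\<in>H. a h \<bullet> x = b h \<longleftrightarrow> h \<in> I}" for I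
  define W where "W I = span (a ` I)" for I
  define q where "q = closest_point P"
  define A where "A I e = {y. q y \<in> F I \<and> dist (q y) y \<le> e}" for I e
  have qP: "q y \<in> P" for y unfolding q_def by (rule closest_point_in_set[OF P(2) assms(3)])
  have qm: "q \<in> borel_measurable borel" unfolding q_def
    by (intro borel_measurable_continuous_onI continuous_on_closest_point P assms)
  have Fm: "F I \<in> sets borel" for I
  proof -
    have "{x. a h \<bullet> x = b h \<longleftrightarrow> h \<in> I} \<in> sets borel" for h
      by (cases "h \<in> I") auto
    then have "P \<inter> (\<Inter>h\<in>H. {x. a h \<bullet> x = b h \<longleftrightarrow> h \<in> I}) \<in> sets borel"
      using P(2) H(1) by (cases "H = {}") (auto intro!: sets.Int sets.finite_INT)
    also have "P \<inter> (\<Inter>h\<in>H. {x. a h \<bullet> x = b h \<longleftrightarrow> h \<in> I}) = F I" by (auto simp: F_def)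
    finally show ?thesis .
  qed
  have Asub: "A I e \<subseteq> parallel_set P e" for I e
    using qP by (auto simp: A_def parallel_set_def)
  have Am: "A I e \<in> lmeasurable" for I e
  proof -
    have "q -` F I \<inter> space borel \<in> sets borel" by (rule measurable_sets[OF qm Fm])
    moreover have "{y. dist (q y) y \<le> e} \<in> sets borel"
      using qm by measurable
    ultimately have "(q -` F I \<inter> space borel) \<inter> {y. dist (q y) y \<le> e} \<in> sets borel" by (rule sets.Int)
    also have "(q -` F I \<inter> space borel) \<inter> {y. dist (q y) y \<le> e} = A I e" by (auto simp: A_def)
    finally have "A I e \<in> sets lebesgue" by (intro sets_completionI_sets) (simp only: sets_lborel)
    moreover have "bounded (A I e)"
      by (rule bounded_subset[OF compact_imp_bounded[OF compact_parallel_set[OF P(3)]] Asub])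
    ultimately show ?thesis by (simp add: bounded_set_imp_lmeasurable)
  qed
  have cell: "measure lebesgue (A I e) = measure lebesgue (A I 1) * e ^ dim (W I)"
    if I: "I \<subseteq> H" and "e > 0" for I e
  proof (cases "F I = {}")
    case False
    have "measure lebesgue (A I e) = e ^ dim (W I) * measure lebesgue (A I 1)"
      unfolding A_def q_def
    proof (rule measure_normal_cell[OF P(1,2) _ False _ _ _ _ \<open>e > 0\<close>])
      show "F I \<subseteq> P" "subspace (W I)" by (auto simp: F_def W_def)
      show "{y. closest_point P y \<in> F I \<and> dist (closest_point P y) y \<le> 1} \<in> lmeasurable"
        using Am[of I 1] by (simp add: A_def q_def)
      fix x assume x: "x \<in> F I"
      show "(x - y) \<bullet> w = 0" if "y \<in> F I" "w \<in> W I" for y w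
      proof -
        have "orthogonal (x - y) w"
        proof (rule orthogonal_to_span[of w "a ` I"])
          fix z assume "z \<in> a ` I"
          then obtain h where "h \<in> I" "z = a h" by auto
          then have "a h \<bullet> x = b h" "a h \<bullet> y = b h" using x that(1) I by (auto simp: F_def)
          then show "orthogonal (x - y) z"
            by (simp add: \<open>z = a h\<close> orthogonal_def inner_commute inner_diff_right)
        qed (use that(2) in \<open>simp add: W_def\<close>)
        then show ?thesis by (simp add: orthogonal_def)
      qed
      fix v assume v: "\<And>z. z \<in> P \<Longrightarrow> v \<bullet> (z - x) \<le> 0"
      \<comment> \<open>Along such \<open>w\<close> the tight constraints stay tight, and the others
        survive small steps. So \<open>P\<close> contains points on both sides of \<open>x\<close>
        in direction \<open>w\<close>.\<close>
      have perp: "v \<bullet> w = 0" if w: "\<And>h. h \<in> I \<Longrightarrow> a h \<bullet> w = 0" for w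
      proof -
        have "\<forall>\<^sub>F t in at 0. x + t *\<^sub>R w \<in> P"
        proof -
          have "\<forall>\<^sub>F t in at 0. a h \<bullet> (x + t *\<^sub>R w) \<le> b h" if "h \<in> H" for h
          proof (cases "h \<in> I")
            case True
            moreover have "a h \<bullet> x \<le> b h" using x that Pmem by (auto simp: F_def)
            ultimately show ?thesis using w by (simp add: inner_add_right)
          next
            case False
            have "a h \<bullet> x \<le> b h" using x that Pmem by (auto simp: F_def)
            moreover have "a h \<bullet> x \<noteq> b h" using x that False by (auto simp: F_def)
            moreover have "((\<lambda>t. a h \<bullet> (x + t *\<^sub>R w)) \<longlongrightarrow> a h \<bullet> (x + 0 *\<^sub>R w)) (at 0)"
              by (intro tendsto_intros)
            ultimately have "\<forall>\<^sub>F t in at 0. a h \<bullet> (x + t *\<^sub>R w) < b h"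
              by (intro order_tendstoD(2)) auto
            then show ?thesis by eventually_elim simp
          qed
          then have "\<forall>\<^sub>F t in at 0. \<forall>h\<in>H. a h \<bullet> (x + t *\<^sub>R w) \<le> b h"
            using H(1) by (simp add: eventually_ball_finite)
          then show ?thesis by (simp add: Pmem)
        qed
        then obtain d where "d > 0" "\<And>t. t \<noteq> 0 \<Longrightarrow> dist t 0 < d \<Longrightarrow> x + t *\<^sub>R w \<in> P"
          by (auto simp: eventually_at)
        then have "x + (d / 2) *\<^sub>R w \<in> P" "x + (- (d / 2)) *\<^sub>R w \<in> P" by (auto simp del: scaleR_minus_left)
        from v[OF this(1)] v[OF this(2)] \<open>d > 0\<close> have "v \<bullet> w \<le> 0" "v \<bullet> w \<ge> 0"
          by (auto simp: mult_le_0_iff zero_le_mult_iff)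
        then show ?thesis by simp
      qed
      \<comment> \<open>The part \<open>z\<close> of \<open>v\<close> orthogonal to
        \<open>W I\<close> satisfies the premise of \<open>perp\<close>, which forces
        \<open>z = 0\<close>.\<close>
      obtain y z where yz: "y \<in> span (a ` I)" "\<And>w. w \<in> span (a ` I) \<Longrightarrow> orthogonal z w" "v = y + z"
        using orthogonal_subspace_decomp_exists[of "a ` I" v] by metis
      have "a h \<bullet> z = 0" if "h \<in> I" for h
        using yz(2)[of "a h"] that by (simp add: span_base orthogonal_def inner_commute)
      then have "v \<bullet> z = 0" by (rule perp)
      moreover have "y \<bullet> z = 0" using yz(2)[OF yz(1)] by (simp add: orthogonal_def inner_commute)
      ultimately have "z = 0" using yz(3) by (simp add: inner_add_left)
      then show "v \<in> W I" using yz by (simp add: W_def)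
    qed
    then show ?thesis by (simp add: mult.commute)
  qed (simp add: A_def)
  show ?thesis
  proof
    let ?p = "\<Sum>I\<in>Pow H. monom (measure lebesgue (A I 1)) (dim (W I))"
    show "degree ?p \<le> CARD('n)"
    proof (rule degree_sum_le)
      show "degree (monom (measure lebesgue (A I 1)) (dim (W I))) \<le> CARD('n)" for I
        using degree_monom_le dim_subset_UNIV_cart[of "W I"] order_trans by blast
    qed (use H(1) in simp)
    fix e :: real assume "e > 0"
    have "parallel_set P e = (\<Union>I\<in>Pow H. A I e)"
    proof (intro equalityI subsetI)
      fix y assume "y \<in> parallel_set P e"
      then obtain x where "x \<in> P" "dist x y \<le> e" by (auto simp: parallel_set_def)
      then have "dist (q y) y \<le> e"
        using closest_point_le[OF P(2), of x y] by (simp add: q_def dist_commute)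
      moreover have "q y \<in> F {h\<in>H. a h \<bullet> q y = b h}" using qP[of y] unfolding F_def by simp
      ultimately have "y \<in> A {h\<in>H. a h \<bullet> q y = b h} e" unfolding A_def by simp
      then show "y \<in> (\<Union>I\<in>Pow H. A I e)" by (rule UN_I[rotated]) auto
    next
      fix y assume "y \<in> (\<Union>I\<in>Pow H. A I e)"
      then obtain I where "y \<in> A I e" by (rule UN_E)
      then show "y \<in> parallel_set P e" by (rule subsetD[OF Asub])
    qed
    moreover have "measure lebesgue (\<Union>I\<in>Pow H. A I e) = (\<Sum>I\<in>Pow H. measure lebesgue (A I e))"
    proof (rule measure_finite_Union)
      show "disjoint_family_on (\<lambda>I. A I e) (Pow H)"
        by (auto simp: disjoint_family_on_def A_def F_def)
    qed (use fmeasurableD[OF Am] fmeasurableD2[OF Am] H(1) in auto)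
    moreover have "\<dots> = (\<Sum>I\<in>Pow H. measure lebesgue (A I 1) * e ^ dim (W I))"
      using \<open>e > 0\<close> by (intro sum.cong refl cell) auto
    ultimately show "measure lebesgue (parallel_set P e) = poly ?p e"
      by (simp add: poly_sum poly_monom)
  qed
qed

section \<open>From polyhedra to compact convex sets\<close>

text \<open>Finitely many small boxes centred in \<open>K\<close> cover \<open>K\<close>. The hull
  of their vertices stays near \<open>K\<close> because parallel sets of \<open>K\<close> are
  convex.\<close>

lemma outer_polyhedron_approximation:
  fixes K :: "'a::euclidean_space set"
  assumes "compact K" "convex K" "d > 0"
  obtains P where "polyhedron P" "bounded P" "K \<subseteq> P" "P \<subseteq> parallel_set K d"
proof -
  \<comment> \<open>With half side \<open>d / DIM('a)\<close>, points of the box have 1-norm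
    distance, hence Euclidean distance, at most \<open>d\<close> from the centre.\<close>
  define C where "C x = cbox (x - (d / DIM('a)) *\<^sub>R One) (x + (d / DIM('a)) *\<^sub>R One)" for x :: 'a
  define U where "U x = box (x - (d / DIM('a)) *\<^sub>R One) (x + (d / DIM('a)) *\<^sub>R One)" for x :: 'a
  have dpos: "d / DIM('a) > 0" using assms(3) by simp
  have Cd: "dist x y \<le> d" if "y \<in> C x" for x y
  proof -
    have "norm (y - x) \<le> (\<Sum>b\<in>Basis. \<bar>(y - x) \<bullet> b\<bar>)" by (rule norm_le_l1)
    also have "\<dots> \<le> (\<Sum>b\<in>(Basis::'a set). d / DIM('a))"
    proof (rule sum_mono)
      fix b :: 'a assume b: "b \<in> Basis"
      then have "x \<bullet> b - d / DIM('a) \<le> y \<bullet> b" "y \<bullet> b \<le> x \<bullet> b + d / DIM('a)"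
        using that by (auto simp: C_def mem_box inner_diff_left inner_add_left)
      then show "\<bar>(y - x) \<bullet> b\<bar> \<le> d / DIM('a)" by (simp add: inner_diff_left)
    qed
    also have "\<dots> = d" by simp
    finally show ?thesis by (simp add: dist_norm norm_minus_commute)
  qed
  have "K \<subseteq> (\<Union>x\<in>K. U x)" using dpos by (auto simp: U_def mem_box inner_diff_left inner_add_left)
  then obtain X where X: "X \<subseteq> K" "finite X" "K \<subseteq> (\<Union>x\<in>X. U x)"
    using compactE_image[OF assms(1), of K U] by (auto simp: U_def)
  have "\<exists>V. finite V \<and> C x = convex hull V" for x
    using polytope_interval unfolding polytope_def C_def by blast
  then obtain V where V: "\<And>x. finite (V x)" "\<And>x. C x = convex hull V x" by metis
  define P where "P = convex hull (\<Union>x\<in>X. V x)"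
  show ?thesis
  proof
    have "finite (\<Union>x\<in>X. V x)" using X(2) V(1) by simp
    then show "polyhedron P" "bounded P" unfolding P_def
      by (simp_all only: polyhedron_convex_hull bounded_convex_hull finite_imp_bounded)
    have "C x \<subseteq> P" if "x \<in> X" for x unfolding V(2) P_def using that by (intro hull_mono) auto
    moreover have "U x \<subseteq> C x" for x unfolding U_def C_def by (rule box_subset_cbox)
    ultimately show "K \<subseteq> P" using X(3) by blast
    have "V x \<subseteq> parallel_set K d" if "x \<in> X" for x
      using hull_subset[of "V x" convex] Cd[of _ x] that X(1) V(2)[of x] by (auto simp: parallel_set_def)
    then show "P \<subseteq> parallel_set K d"
      unfolding P_def by (intro hull_minimal convex_parallel_set assms) auto
  qed
qed

text \<open>By Lagrange interpolation, a polynomial is a fixed linear combination of finitely many of its values.\<close>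
lemma pointwise_limit_of_polynomials:
  fixes p :: "nat \<Rightarrow> real poly" and f :: "real \<Rightarrow> real"
  assumes deg: "\<And>n. degree (p n) \<le> d" and lim: "\<And>e. e > 0 \<Longrightarrow> (\<lambda>n. poly (p n) e) \<longlonglongrightarrow> f e"
  obtains q where "degree q \<le> d" "\<And>e. e > 0 \<Longrightarrow> f e = poly q e"
proof -
  \<comment> \<open>Lagrange basis for the nodes \<open>1, ..., d + 1\<close>. The shift by one
    keeps all nodes positive, where convergence is given.\<close>
  define L :: "nat \<Rightarrow> real poly" where
    "L i = (\<Prod>m\<in>{..d} - {i}. smult (1 / (real i - real m)) [:- (real m + 1), 1:])" for i
  have degL: "degree (L i) \<le> d" if "i \<le> d" for i
  proof -
    have "degree (L i) \<le> (\<Sum>m\<in>{..d} - {i}. degree (smult (1 / (real i - real m)) [:- (real m + 1), 1:]))"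
      unfolding L_def by (rule degree_prod_sum_le[unfolded o_def]) simp
    also have "\<dots> \<le> (\<Sum>m\<in>{..d} - {i}. 1)"
      by (intro sum_mono order_trans[OF degree_smult_le]) simp
    also have "\<dots> = d" using that by (simp add: card_Diff_singleton)
    finally show ?thesis .
  qed
  have polyL: "poly (L i) (real m + 1) = (if i = m then 1 else 0)" if "i \<le> d" "m \<le> d" for i m
  proof (cases "i = m")
    case True
    have "poly (L i) (real i + 1) = (\<Prod>m\<in>{..d} - {i}. 1)"
      unfolding L_def poly_prod
    proof (rule prod.cong)
      fix m assume "m \<in> {..d} - {i}"
      then have "real i - real m \<noteq> 0" by auto
      then show "poly (smult (1 / (real i - real m)) [:- (real m + 1), 1:]) (real i + 1) = 1"
        unfolding poly_smult by simp
    qed simp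
    then show ?thesis using True by simp
  next
    case False
    have "poly (L i) (real m + 1) = 0" unfolding L_def poly_prod
    proof (rule prod_zero)
      show "\<exists>k\<in>{..d} - {i}. poly (smult (1 / (real i - real k)) [:- (real k + 1), 1:]) (real m + 1) = 0"
        using False that unfolding poly_smult by (intro bexI[of _ m]) simp_all
    qed simp
    then show ?thesis using False by simp
  qed
  have degsum: "degree (\<Sum>i\<le>d. smult (c i) (L i)) \<le> d" for c
    by (intro degree_sum_le order_trans[OF degree_smult_le] degL) auto
  have interp: "p n = (\<Sum>i\<le>d. smult (poly (p n) (real i + 1)) (L i))" for n
  proof (rule poly_eqI_degree)
    have "card ((\<lambda>i. real i + 1) ` {..d}) = d + 1" by (subst card_image) (auto simp: inj_on_def)
    then show "degree (p n) < card ((\<lambda>i. real i + 1) ` {..d})"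
      "degree (\<Sum>i\<le>d. smult (poly (p n) (real i + 1)) (L i)) < card ((\<lambda>i. real i + 1) ` {..d})"
      using deg[of n] degsum[of "\<lambda>i. poly (p n) (real i + 1)"] by linarith+
    fix x assume "x \<in> (\<lambda>i. real i + 1) ` {..d}"
    then obtain m where m: "m \<le> d" "x = real m + 1" by auto
    have "poly (\<Sum>i\<le>d. smult (poly (p n) (real i + 1)) (L i)) x
        = (\<Sum>i\<le>d. if i = m then poly (p n) (real i + 1) else 0)"
      unfolding poly_sum m(2) using polyL m(1) by (intro sum.cong) auto
    then show "poly (p n) x = poly (\<Sum>i\<le>d. smult (poly (p n) (real i + 1)) (L i)) x"
      using m by simp
  qed
  show ?thesis
  proof
    show "degree (\<Sum>i\<le>d. smult (f (real i + 1)) (L i)) \<le> d" by (rule degsum)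
    fix e :: real assume "e > 0"
    have "(\<lambda>n. \<Sum>i\<le>d. poly (p n) (real i + 1) * poly (L i) e) \<longlonglongrightarrow> (\<Sum>i\<le>d. f (real i + 1) * poly (L i) e)"
      by (intro tendsto_intros lim) auto
    moreover have "(\<lambda>n. \<Sum>i\<le>d. poly (p n) (real i + 1) * poly (L i) e) = (\<lambda>n. poly (p n) e)"
      by (subst (2) interp) (simp add: poly_sum)
    ultimately have "f e = (\<Sum>i\<le>d. f (real i + 1) * poly (L i) e)"
      using lim[OF \<open>e > 0\<close>] LIMSEQ_unique by metis
    then show "f e = poly (\<Sum>i\<le>d. smult (f (real i + 1)) (L i)) e" by (simp add: poly_sum)
  qed
qed

text \<open>The volumes of the parallel sets of outer polyhedra are polynomials in \<open>e\<close>
  of bounded degree and converge to those of \<open>K\<close>, so the limit is again such a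
  polynomial.\<close>

lemma steiner_formula:
  fixes K :: "(real^'n) set"
  assumes "compact K" "convex K"
  obtains p where "degree p \<le> CARD('n)" "\<And>e. e > 0 \<Longrightarrow> measure lebesgue (parallel_set K e) = poly p e"
proof (cases "K = {}")
  case True
  then show ?thesis using that[of 0] by (simp add: parallel_set_def)
next
  case False
  have "\<exists>P p. K \<subseteq> P \<and> P \<subseteq> parallel_set K (1 / real (Suc n)) \<and> compact P \<and> degree p \<le> CARD('n) \<and>
      (\<forall>e>0. measure lebesgue (parallel_set P e) = poly p e)" for n
  proof -
    obtain P where P: "polyhedron P" "bounded P" "K \<subseteq> P" "P \<subseteq> parallel_set K (1 / real (Suc n))"
      using outer_polyhedron_approximation[OF assms, of "1 / real (Suc n)"] by auto
    then have "compact P" using polyhedron_imp_closed compact_eq_bounded_closed by blast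
    moreover obtain p where "degree p \<le> CARD('n)" "\<And>e. e > 0 \<Longrightarrow> measure lebesgue (parallel_set P e) = poly p e"
      using steiner_polyhedron[OF P(1,2)] P(3) False by blast
    ultimately show ?thesis using P by blast
  qed
  then obtain P p where P: "\<And>n. K \<subseteq> P n" "\<And>n. P n \<subseteq> parallel_set K (1 / real (Suc n))" "\<And>n. compact (P n)"
    and p: "\<And>n. degree (p n) \<le> CARD('n)" "\<And>n e. e > 0 \<Longrightarrow> measure lebesgue (parallel_set (P n) e) = poly (p n) e"
    by metis
  have lim: "(\<lambda>n. poly (p n) e) \<longlonglongrightarrow> measure lebesgue (parallel_set K e)" if "e > 0" for e
  proof (rule LIMSEQ_I)
    fix \<eta> :: real assume "\<eta> > 0"
    let ?S = "parallel_set K e"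
    have S: "bounded ?S" "negligible (frontier ?S)"
      using compact_parallel_set[OF assms(1)] convex_parallel_set[OF assms(2)]
      by (auto intro: compact_imp_bounded negligible_convex_frontier)
    \<comment> \<open>Volume is upper semicontinuous under small enlargements of \<open>?S\<close>,
      since the boundary of a convex set is null.\<close>
    obtain \<delta> where \<delta>: "\<delta> > 0"
      "\<And>T. \<lbrakk>T \<in> lmeasurable; \<And>y. y \<in> T \<Longrightarrow> \<exists>x. x \<in> ?S \<and> dist x y < \<delta>\<rbrakk> \<Longrightarrow> measure lebesgue T < measure lebesgue ?S + \<eta>"
      using measure_semicontinuous_with_hausdist_explicit[OF S \<open>\<eta> > 0\<close>] by metis
    obtain N where N: "1 / real (Suc N) < \<delta>" using \<delta>(1) nat_approx_posE by blast
    have "norm (poly (p n) e - measure lebesgue ?S) < \<eta>" if n: "n \<ge> N" for n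
    proof -
      have lm: "parallel_set (P n) e \<in> lmeasurable" "?S \<in> lmeasurable"
        by (intro lmeasurable_compact compact_parallel_set P assms)+
      have "?S \<subseteq> parallel_set (P n) e" using P(1) by (auto simp: parallel_set_def)
      then have 1: "measure lebesgue ?S \<le> measure lebesgue (parallel_set (P n) e)"
        using lm by (intro measure_mono_fmeasurable) auto
      have "\<exists>x. x \<in> ?S \<and> dist x y < \<delta>" if y: "y \<in> parallel_set (P n) e" for y
      proof -
        obtain x where x: "x \<in> P n" "dist x y \<le> e" using y by (auto simp: parallel_set_def)
        obtain z where z: "z \<in> K" "dist z x \<le> 1 / real (Suc n)" using x(1) P(2) by (auto simp: parallel_set_def)
        have "1 / real (Suc n) \<le> 1 / real (Suc N)" using n by (simp add: frac_le)
        then have "dist z x < \<delta>" using z(2) N by linarith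
        \<comment> \<open>The translation that takes \<open>x\<close> to \<open>z\<close> takes
          \<open>y\<close> to a point within \<open>e\<close> of \<open>z\<close>.\<close>
        then have "dist (y + (z - x)) y < \<delta>" by (simp add: dist_norm)
        moreover have "y + (z - x) \<in> ?S" using x(2) z(1)
          by (auto simp: parallel_set_def dist_norm algebra_simps intro!: bexI[of _ z])
        ultimately show ?thesis by blast
      qed
      then have "measure lebesgue (parallel_set (P n) e) < measure lebesgue ?S + \<eta>"
        using \<delta>(2) lm(1) by blast
      then show ?thesis using 1 p(2)[OF \<open>e > 0\<close>, of n] by simp
    qed
    then show "\<exists>N. \<forall>n\<ge>N. norm (poly (p n) e - measure lebesgue ?S) < \<eta>" by blast
  qed
  show ?thesis by (rule pointwise_limit_of_polynomials[OF p(1) lim]) (auto intro: that)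
qed

section \<open>Intrinsic volumes on the convex ring\<close>

lemma unit_ball_vol_pos: "unit_ball_vol j > 0"
  by (simp add: unit_ball_vol_def)

text \<open>A polynomial with infinitely many zeros vanishes, and the factors
  \<open>unit_ball_vol\<close> are nonzero. Identities between volumes of parallel sets pass to
  intrinsic volumes this way.\<close>

lemma steiner_polynomial_eq_0:
  assumes "\<And>e. e > 0 \<Longrightarrow> (\<Sum>j\<le>d. unit_ball_vol (d - j) * c j * e ^ (d - j)) = 0" "j \<le> d"
  shows "c j = 0"
proof -
  define p where "p = (\<Sum>j\<le>d. monom (unit_ball_vol (d - j) * c j) (d - j))"
  have "poly p e = 0" if "e > 0" for e
    using assms(1)[OF that] by (simp add: p_def poly_sum poly_monom)
  then have "{0<..} \<subseteq> {e. poly p e = 0}" by auto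
  then have "infinite {e. poly p e = 0}" using infinite_Ioi finite_subset by blast
  then have "p = 0" using poly_roots_finite by blast
  moreover have "coeff p (d - j) = (\<Sum>i\<le>d. if i = j then unit_ball_vol (d - j) * c j else 0)"
    unfolding p_def coeff_sum using assms(2) by (intro sum.cong) (auto simp: coeff_monom)
  ultimately show ?thesis using assms(2) unit_ball_vol_pos[of "d - j"] by simp
qed

lemma measure_parallel_set_lborel:
  "compact K \<Longrightarrow> measure lborel (parallel_set K e) = measure lebesgue (parallel_set K e)"
  for K :: "'a::euclidean_space set"
  by (simp add: borel_compact compact_parallel_set)

lemma steiner_coeffs_unique:
  fixes K :: "'a::euclidean_space set"
  assumes "steiner_coeffs K c" "steiner_coeffs K c'"
  shows "c = c'"
proof
  fix j
  show "c j = c' j"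
  proof (cases "j \<le> DIM('a)")
    case True
    have "c j - c' j = 0"
    proof (rule steiner_polynomial_eq_0[OF _ True, where c = "\<lambda>j. c j - c' j"])
      fix e :: real assume "e > 0"
      then show "(\<Sum>j\<le>DIM('a). unit_ball_vol (DIM('a) - j) * (c j - c' j) * e ^ (DIM('a) - j)) = 0"
        using assms unfolding steiner_coeffs_def by (simp add: algebra_simps sum_subtractf)
    qed
    then show ?thesis by simp
  qed (use assms in \<open>auto simp: steiner_coeffs_def\<close>)
qed

lemma steiner_coeffs_exist:
  fixes K :: "(real^'n) set"
  assumes "compact K" "convex K"
  obtains c where "steiner_coeffs K c"
proof -
  let ?d = "CARD('n)"
  obtain p where p: "degree p \<le> ?d" "\<And>e. e > 0 \<Longrightarrow> measure lebesgue (parallel_set K e) = poly p e"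
    using steiner_formula[OF assms] by metis
  define c where "c j = (if j \<le> ?d then coeff p (?d - j) / unit_ball_vol (?d - j) else 0)" for j
  have nz: "unit_ball_vol j \<noteq> 0" for j using unit_ball_vol_pos[of j] by simp
  have "measure lborel (parallel_set K e) = (\<Sum>j\<le>?d. unit_ball_vol (?d - j) * c j * e ^ (?d - j))"
    if "e > 0" for e
  proof -
    have "measure lborel (parallel_set K e) = (\<Sum>i\<le>degree p. coeff p i * e ^ i)"
      using p(2)[OF that] measure_parallel_set_lborel[OF assms(1)] by (simp add: poly_altdef)
    also have "\<dots> = (\<Sum>i\<le>?d. coeff p i * e ^ i)"
      using p(1) by (intro sum.mono_neutral_left) (auto simp: coeff_eq_0)
    also have "\<dots> = (\<Sum>j\<le>?d. unit_ball_vol (?d - j) * c j * e ^ (?d - j))"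
      by (rule sum.reindex_bij_witness[of _ "\<lambda>j. ?d - j" "\<lambda>j. ?d - j"]) (auto simp: c_def nz)
    finally show ?thesis .
  qed
  then have "steiner_coeffs K c" by (simp add: steiner_coeffs_def c_def)
  then show ?thesis by (rule that)
qed

text \<open>Existence and uniqueness resolve the definite description in
  \<open>intrinsic_volume_convex\<close>. The empty set fits because both sides are then
  \<open>0\<close>.\<close>

lemma measure_parallel_set:
  fixes K :: "(real^'n) set"
  assumes "compact K" "convex K" "e > 0"
  shows "measure lebesgue (parallel_set K e) =
    (\<Sum>j\<le>CARD('n). unit_ball_vol (CARD('n) - j) * intrinsic_volume_convex j K * e ^ (CARD('n) - j))"
proof (cases "K = {}")
  case True
  then show ?thesis by (simp add: parallel_set_def intrinsic_volume_convex_def)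
next
  case False
  obtain c where c: "steiner_coeffs K c" using steiner_coeffs_exist[OF assms(1,2)] .
  then have "(THE c. steiner_coeffs K c) = c" using steiner_coeffs_unique by blast
  then have "intrinsic_volume_convex j K = c j" for j using False by (simp add: intrinsic_volume_convex_def)
  then show ?thesis
    using c assms(3) measure_parallel_set_lborel[OF assms(1), of e] by (simp add: steiner_coeffs_def)
qed

text \<open>The parallel set of the scaled copy at distance \<open>e\<close> is the scaled copy of
  the parallel set at distance \<open>e / t\<close>; then coefficients are compared.\<close>

lemma intrinsic_volume_convex_homothety:
  fixes K :: "(real^'n) set"
  assumes "compact K" "convex K" "t > 0" "k \<le> CARD('n)"
  shows "intrinsic_volume_convex k ((\<lambda>x. a + t *\<^sub>R x) ` K) = t ^ k * intrinsic_volume_convex k K"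
proof -
  let ?d = "CARD('n)" and ?K = "(\<lambda>x. a + t *\<^sub>R x) ` K"
  have K: "compact ?K" "convex ?K"
    using assms(1,2) by (auto simp: image_image[of "(+) a" "\<lambda>x. t *\<^sub>R x", symmetric] convex_translation_eq
        intro!: compact_translation compact_scaling convex_scaling)
  have "intrinsic_volume_convex k ?K - t ^ k * intrinsic_volume_convex k K = 0"
  proof (rule steiner_polynomial_eq_0[OF _ assms(4),
        where c = "\<lambda>k. intrinsic_volume_convex k ?K - t ^ k * intrinsic_volume_convex k K"])
    fix e :: real assume e: "e > 0"
    have d: "dist (a + t *\<^sub>R x) (a + t *\<^sub>R y) = t * dist x y" for x y :: "real^'n"
      using assms(3) by (simp add: dist_norm flip: scaleR_diff_right)
    have "parallel_set ?K e = (\<lambda>x. a + t *\<^sub>R x) ` parallel_set K (e / t)"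
    proof (intro equalityI subsetI)
      fix y assume "y \<in> parallel_set ?K e"
      then obtain x where x: "x \<in> K" "dist (a + t *\<^sub>R x) y \<le> e" by (auto simp: parallel_set_def)
      define z where "z = (1 / t) *\<^sub>R (y - a)"
      have y: "y = a + t *\<^sub>R z" using assms(3) by (simp add: z_def)
      then have "dist x z \<le> e / t" using x(2) d assms(3) by (simp add: field_simps)
      then show "y \<in> (\<lambda>x. a + t *\<^sub>R x) ` parallel_set K (e / t)" using x(1) y by (auto simp: parallel_set_def)
    next
      fix y assume "y \<in> (\<lambda>x. a + t *\<^sub>R x) ` parallel_set K (e / t)"
      then obtain z x where z: "y = a + t *\<^sub>R z" "x \<in> K" "dist x z \<le> e / t" by (auto simp: parallel_set_def)
      then have "dist (a + t *\<^sub>R x) y \<le> e" using d assms(3) by (simp add: field_simps)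
      then show "y \<in> parallel_set ?K e" using z by (auto simp: parallel_set_def)
    qed
    then have "measure lebesgue (parallel_set ?K e) = t ^ ?d * measure lebesgue (parallel_set K (e / t))"
      using measure_lebesgue_affine[of t a "parallel_set K (e / t)"] assms(3) by (simp add: add.commute)
    also have "\<dots> = (\<Sum>j\<le>?d. t ^ ?d * (unit_ball_vol (?d - j) * intrinsic_volume_convex j K * (e / t) ^ (?d - j)))"
      using measure_parallel_set[OF assms(1,2), of "e / t"] assms(3) e by (simp add: sum_distrib_left)
    also have "\<dots> = (\<Sum>j\<le>?d. unit_ball_vol (?d - j) * (t ^ j * intrinsic_volume_convex j K) * e ^ (?d - j))"
    proof (intro sum.cong refl)
      fix j assume "j \<in> {..?d}"
      then have "t ^ ?d = t ^ j * t ^ (?d - j)" by (simp flip: power_add)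
      then show "t ^ ?d * (unit_ball_vol (?d - j) * intrinsic_volume_convex j K * (e / t) ^ (?d - j))
          = unit_ball_vol (?d - j) * (t ^ j * intrinsic_volume_convex j K) * e ^ (?d - j)"
        using assms(3) by (simp add: power_divide)
    qed
    finally show "(\<Sum>j\<le>?d. unit_ball_vol (?d - j) * (intrinsic_volume_convex j ?K - t ^ j * intrinsic_volume_convex j K) * e ^ (?d - j)) = 0"
      using measure_parallel_set[OF K e] by (simp add: algebra_simps sum_subtractf)
  qed
  then show ?thesis by simp
qed

text \<open>Groemer's theorem. Integrating the Euler characteristic of the intersections with the balls of
  radius \<open>e\<close> gives the volume of the parallel sets, so that the relation between indicators passes to
  these volumes and then to the coefficients of the Steiner polynomials.\<close>
lemma intrinsic_volume_convex_linear_relation: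
  fixes K :: "'i \<Rightarrow> (real^'n) set" and a :: "'i \<Rightarrow> real"
  assumes "finite I" and K: "\<And>i. i \<in> I \<Longrightarrow> compact (K i)" "\<And>i. i \<in> I \<Longrightarrow> convex (K i)"
    and zero: "\<And>x. (\<Sum>i\<in>I. a i * indicator (K i) x) = 0" and "k \<le> CARD('n)"
  shows "(\<Sum>i\<in>I. a i * intrinsic_volume_convex k (K i)) = 0"
proof (rule steiner_polynomial_eq_0[OF _ assms(5), where c = "\<lambda>k. \<Sum>i\<in>I. a i * intrinsic_volume_convex k (K i)"])
  fix e :: real assume e: "e > 0"
  let ?d = "CARD('n)"
  have lm: "parallel_set (K i) e \<in> lmeasurable" if "i \<in> I" for i
    using K(1)[OF that] by (intro lmeasurable_compact compact_parallel_set)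
  have "(\<Sum>i\<in>I. a i * indicator (parallel_set (K i) e) y) = 0" for y
  proof -
    have "(\<Sum>i\<in>I. a i * of_bool (K i \<inter> cball y e \<noteq> {})) = 0"
    proof (rule euler_characteristic_eq_0[OF assms(1)])
      fix x
      have "(\<Sum>i\<in>I. a i * indicator (K i \<inter> cball y e) x) = (\<Sum>i\<in>I. a i * indicator (K i) x) * indicator (cball y e) x"
        by (simp add: sum_distrib_right indicator_inter_arith mult.assoc)
      then show "(\<Sum>i\<in>I. a i * indicator (K i \<inter> cball y e) x) = 0" using zero by simp
    qed (auto intro!: compact_Int convex_Int K)
    moreover have "of_bool (K i \<inter> cball y e \<noteq> {}) = (indicator (parallel_set (K i) e) y :: real)" for i
      by (simp add: parallel_set_Int_cball indicator_def)
    ultimately show ?thesis by simp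
  qed
  then have "0 = integral\<^sup>L lebesgue (\<lambda>y. \<Sum>i\<in>I. a i * indicator (parallel_set (K i) e) y)" by simp
  also have "\<dots> = (\<Sum>i\<in>I. integral\<^sup>L lebesgue (\<lambda>y. a i * indicator (parallel_set (K i) e) y))"
    using fmeasurableD[OF lm] fmeasurableD2[OF lm]
    by (intro Bochner_Integration.integral_sum integrable_mult_right integrable_real_indicator) (auto simp: less_top)
  also have "\<dots> = (\<Sum>i\<in>I. a i * measure lebesgue (parallel_set (K i) e))" by simp
  also have "\<dots> = (\<Sum>i\<in>I. \<Sum>j\<le>?d. a i * (unit_ball_vol (?d - j) * intrinsic_volume_convex j (K i) * e ^ (?d - j)))"
    using measure_parallel_set[OF K e] by (simp add: sum_distrib_left)
  also have "\<dots> = (\<Sum>j\<le>?d. unit_ball_vol (?d - j) * (\<Sum>i\<in>I. a i * intrinsic_volume_convex j (K i)) * e ^ (?d - j))"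
    by (subst sum.swap) (simp add: sum_distrib_left sum_distrib_right algebra_simps)
  finally show "(\<Sum>j\<le>?d. unit_ball_vol (?d - j) * (\<Sum>i\<in>I. a i * intrinsic_volume_convex j (K i)) * e ^ (?d - j)) = 0"
    by simp
qed

section \<open>Inclusion-exclusion for labelled families\<close>

text \<open>Expansion of the product over \<open>A\<close> of the factor
  \<open>-1 + 1\<close>.\<close>

lemma alternating_sum_Pow:
  assumes "finite A"
  shows "(\<Sum>S\<in>Pow A. (-1) ^ card S) = (if A = {} then 1 else (0::real))"
  using prod_add[OF assms, of "\<lambda>_. -1" "\<lambda>_. 1 :: real"] assms by (simp add: power_0_left)

lemma alternating_sum_Pow_nonempty:
  assumes "finite A"
  shows "(\<Sum>S\<in>Pow A - {{}}. (-1) ^ card S) = (if A = {} then 0 else (-1::real))"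
  using alternating_sum_Pow[OF assms] assms by (subst sum_diff1) auto

text \<open>A set \<open>S\<close> with image \<open>T\<close> is an independent choice of a
  nonempty subset in each fibre over \<open>T\<close>. A nonempty fibre contributes
  \<open>-1\<close>, an empty one \<open>0\<close>.\<close>

lemma alternating_sum_image_eq:
  fixes f :: "'i \<Rightarrow> 'j"
  assumes "finite T" "finite Z"
  shows "(\<Sum>S\<in>{S\<in>Pow Z. f ` S = T}. (-1) ^ card S) = (if T \<subseteq> f ` Z then (-1) ^ card T else (0::real))"
  using assms
proof (induction T arbitrary: Z rule: finite_induct)
  case empty
  have "{S\<in>Pow Z. f ` S = {}} = {{}}" by auto
  then show ?case by simp
next
  case (insert j T)
  define Y where "Y = {i\<in>Z. f i = j}"
  have Y: "Y \<subseteq> Z" "finite Y" "finite (Z - Y)" using insert.prems by (auto simp: Y_def)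
  have "(\<Sum>S\<in>{S\<in>Pow Z. f ` S = insert j T}. (-1) ^ card S)
      = (\<Sum>(A, B)\<in>(Pow Y - {{}}) \<times> {S\<in>Pow (Z - Y). f ` S = T}. (-1) ^ card A * (-1::real) ^ card B)"
  proof (rule sum.reindex_bij_witness[of _ "\<lambda>(A, B). A \<union> B" "\<lambda>S. (S \<inter> Y, S - Y)"])
    fix S assume "S \<in> {S\<in>Pow Z. f ` S = insert j T}"
    then have S: "S \<subseteq> Z" "f ` S = insert j T" by auto
    obtain i where "i \<in> S" "f i = j" using S(2) by (metis imageE insertI1)
    then have "S \<inter> Y \<noteq> {}" using S(1) by (auto simp: Y_def)
    moreover have "f ` (S - Y) = T"
    proof (intro equalityI subsetI)
      fix y assume "y \<in> T"
      then obtain i where "i \<in> S" "y = f i" using S(2) by (metis imageE insertI2)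
      then show "y \<in> f ` (S - Y)" using \<open>y \<in> T\<close> insert.hyps(2) by (auto simp: Y_def)
    qed (use S in \<open>auto simp: Y_def\<close>)
    ultimately show "(S \<inter> Y, S - Y) \<in> (Pow Y - {{}}) \<times> {S\<in>Pow (Z - Y). f ` S = T}" using S by auto
    have "finite S" using S(1) insert.prems finite_subset by blast
    then have "card (S \<inter> Y) + card (S - Y) = card S"
      by (metis card_Int_Diff)
    then show "(case (S \<inter> Y, S - Y) of (A, B) \<Rightarrow> (-1) ^ card A * (-1::real) ^ card B) = (-1) ^ card S"
      by (simp flip: power_add)
  next
    fix AB assume "AB \<in> (Pow Y - {{}}) \<times> {S\<in>Pow (Z - Y). f ` S = T}"
    then obtain A B where AB: "AB = (A, B)" "A \<subseteq> Y" "A \<noteq> {}" "B \<subseteq> Z - Y" "f ` B = T" by auto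
    then have "f ` A = {j}" by (auto simp: Y_def)
    then show "(case AB of (A, B) \<Rightarrow> A \<union> B) \<in> {S\<in>Pow Z. f ` S = insert j T}"
      using AB Y(1) by (auto simp: image_Un)
    show "((case AB of (A, B) \<Rightarrow> A \<union> B) \<inter> Y, (case AB of (A, B) \<Rightarrow> A \<union> B) - Y) = AB" using AB by auto
  qed auto
  also have "\<dots> = (\<Sum>A\<in>Pow Y - {{}}. (-1) ^ card A) * (\<Sum>B\<in>{S\<in>Pow (Z - Y). f ` S = T}. (-1) ^ card B)"
    by (simp add: sum_product sum.cartesian_product)
  also have "\<dots> = (if Y = {} then 0 else -1) * (if T \<subseteq> f ` (Z - Y) then (-1) ^ card T else 0)"
    by (simp only: alternating_sum_Pow_nonempty[OF Y(2)] insert.IH[OF Y(3)])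
  also have "\<dots> = (if insert j T \<subseteq> f ` Z then (-1) ^ card (insert j T) else 0)"
  proof -
    have "Y = {} \<longleftrightarrow> j \<notin> f ` Z" by (auto simp: Y_def)
    moreover have "T \<subseteq> f ` (Z - Y) \<longleftrightarrow> T \<subseteq> f ` Z" using insert.hyps(2) by (auto simp: Y_def)
    ultimately show ?thesis using insert.hyps by simp
  qed
  finally show ?case .
qed

text \<open>At \<open>x\<close> only the indices with \<open>x\<close> in \<open>K i\<close> matter,
  and \<open>alternating_sum_image_eq\<close> evaluates the remaining sum. A constant label gives
  ordinary inclusion-exclusion.\<close>

lemma indicator_INT_UN:
  fixes K :: "'i \<Rightarrow> 'a set" and f :: "'i \<Rightarrow> 'j"
  assumes "finite G" "finite T"
  shows "indicator (\<Inter>j\<in>T. \<Union>i\<in>{i\<in>G. f i = j}. K i) x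
    = (\<Sum>S\<in>{S\<in>Pow G. f ` S = T}. (-1) ^ (card T + card S) * indicator (\<Inter>i\<in>S. K i) x :: real)"
proof -
  define Z where "Z = {i\<in>G. x \<in> K i}"
  have "(\<Sum>S\<in>{S\<in>Pow G. f ` S = T}. (-1) ^ (card T + card S) * indicator (\<Inter>i\<in>S. K i) x)
      = (\<Sum>S\<in>{S\<in>Pow Z. f ` S = T}. (-1) ^ card T * (-1::real) ^ card S)"
    using assms(1) by (intro sum.mono_neutral_cong_right) (auto simp: Z_def indicator_def power_add)
  also have "\<dots> = (-1) ^ card T * (if T \<subseteq> f ` Z then (-1) ^ card T else 0)"
    using assms by (simp only: flip: sum_distrib_left) (subst alternating_sum_image_eq, auto simp: Z_def)
  also have "\<dots> = of_bool (T \<subseteq> f ` Z)" by (simp flip: power_add)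
  also have "\<dots> = indicator (\<Inter>j\<in>T. \<Union>i\<in>{i\<in>G. f i = j}. K i) x"
    by (auto simp: Z_def indicator_def image_iff subset_iff)
  finally show ?thesis by simp
qed

text \<open>Two representations of one indicator differ by a linear relation, so Groemer's theorem
  gives them equal values. The family \<open>\<L>\<close> shows that \<open>A\<close> is a union as
  in the definition; otherwise every \<open>v\<close> would satisfy the defining condition.\<close>

lemma intrinsic_volume_eqI:
  fixes K :: "'i \<Rightarrow> (real^'n) set" and a :: "'i \<Rightarrow> real"
  assumes "finite I" and K: "\<And>i. i \<in> I \<Longrightarrow> compact (K i)" "\<And>i. i \<in> I \<Longrightarrow> convex (K i)"
    and A: "\<And>x. indicator A x = (\<Sum>i\<in>I. a i * indicator (K i) x)" and k: "k \<le> CARD('n)"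
    and \<L>: "finite \<L>" "\<And>L. L \<in> \<L> \<Longrightarrow> compact L" "\<And>L. L \<in> \<L> \<Longrightarrow> convex L" "\<Union>\<L> = A"
  shows "intrinsic_volume k A = (\<Sum>i\<in>I. a i * intrinsic_volume_convex k (K i))"
proof -
  have rep: "(\<Sum>i\<in>I. a i * intrinsic_volume_convex k (K i))
      = (\<Sum>\<S>\<in>Pow \<K> - {{}}. (-1) ^ (card \<S> - 1) * intrinsic_volume_convex k (\<Inter>\<S>))"
    if \<K>: "finite \<K>" "\<forall>K\<in>\<K>. compact K \<and> convex K" "\<Union>\<K> = A" for \<K>
  proof -
    have ind: "indicator A x = (\<Sum>\<S>\<in>Pow \<K> - {{}}. (-1) ^ (card \<S> - 1) * indicator (\<Inter>\<S>) x :: real)" for x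
    proof -
      have "indicator A x = (indicator (\<Inter>j\<in>{()}. \<Union>i\<in>{i\<in>\<K>. () = j}. i) x :: real)"
        using \<K>(3) by simp
      also have "\<dots> = (\<Sum>S\<in>{S\<in>Pow \<K>. (\<lambda>_. ()) ` S = {()}}. (-1) ^ (card {()} + card S) * indicator (\<Inter>i\<in>S. i) x)"
        by (rule indicator_INT_UN) (use \<K>(1) in auto)
      also have "\<dots> = (\<Sum>\<S>\<in>Pow \<K> - {{}}. (-1) ^ (card \<S> - 1) * indicator (\<Inter>\<S>) x)"
      proof (intro sum.cong)
        fix S assume S: "S \<in> Pow \<K> - {{}}"
        then have "card S > 0" using \<K>(1) finite_subset by (auto simp: card_gt_0_iff)
        then obtain m where "card S = Suc m" by (cases "card S") auto
        then show "(-1) ^ (card {()} + card S) * indicator (\<Inter>i\<in>S. i) x = (-1) ^ (card S - 1) * (indicator (\<Inter>S) x :: real)"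
          by simp
      qed auto
      finally show ?thesis .
    qed
    \<comment> \<open>The disjoint sum of the index sets collects both representations, the second
      with opposite sign, in one vanishing combination.\<close>
    let ?J = "I <+> (Pow \<K> - {{}})"
    have "(\<Sum>z\<in>?J. case_sum a (\<lambda>\<S>. - ((-1) ^ (card \<S> - 1))) z * intrinsic_volume_convex k (case_sum K (\<lambda>\<S>. \<Inter>\<S>) z)) = 0"
    proof (rule intrinsic_volume_convex_linear_relation[OF _ _ _ _ k])
      show "finite ?J" using assms(1) \<K>(1) by simp
      show "compact (case_sum K (\<lambda>\<S>. \<Inter>\<S>) z)" "convex (case_sum K (\<lambda>\<S>. \<Inter>\<S>) z)" if "z \<in> ?J" for z
      proof -
        show "compact (case_sum K (\<lambda>\<S>. \<Inter>\<S>) z)"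
        proof (cases z)
          case (Inr \<S>)
          with that have \<S>: "\<S> \<subseteq> \<K>" "\<S> \<noteq> {}" by auto
          then obtain L where "L \<in> \<S>" by auto
          then have "compact (L \<inter> \<Inter>\<S>)" using \<K>(2) \<S>(1)
            by (intro compact_Int_closed closed_Inter) (auto intro: compact_imp_closed)
          then show ?thesis using Inr \<open>L \<in> \<S>\<close> by (simp add: Int_absorb1 Inter_lower)
        qed (use that K in auto)
        show "convex (case_sum K (\<lambda>\<S>. \<Inter>\<S>) z)"
          using that K \<K>(2) by (cases z) (auto intro!: convex_Inter)
      qed
      fix x
      have "(\<Sum>z\<in>?J. case_sum a (\<lambda>\<S>. - ((-1) ^ (card \<S> - 1))) z * indicator (case_sum K (\<lambda>\<S>. \<Inter>\<S>) z) x)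
          = (\<Sum>i\<in>I. a i * indicator (K i) x) + (\<Sum>\<S>\<in>Pow \<K> - {{}}. - ((-1) ^ (card \<S> - 1) * indicator (\<Inter>\<S>) x))"
        using assms(1) \<K>(1) by (subst sum.Plus) simp_all
      also have "\<dots> = 0" by (simp only: sum_negf A[symmetric] ind[symmetric] add.right_inverse)
      finally show "(\<Sum>z\<in>?J. case_sum a (\<lambda>\<S>. - ((-1) ^ (card \<S> - 1))) z * indicator (case_sum K (\<lambda>\<S>. \<Inter>\<S>) z) x) = 0" .
    qed
    then show ?thesis using assms(1) \<K>(1) by (simp add: sum.Plus sum_negf)
  qed
  show ?thesis unfolding intrinsic_volume_def
  proof (rule the_equality)
    fix v assume "\<forall>\<K>. finite \<K> \<and> (\<forall>K\<in>\<K>. compact K \<and> convex K) \<and> \<Union>\<K> = A \<longrightarrow>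
      v = (\<Sum>\<S>\<in>Pow \<K> - {{}}. (-1) ^ (card \<S> - 1) * intrinsic_volume_convex k (\<Inter>\<S>))"
    then show "v = (\<Sum>i\<in>I. a i * intrinsic_volume_convex k (K i))"
      using \<L> rep[of \<L>] by auto
  qed (use rep in blast)
qed

text \<open>Distributing the intersection over the unions yields a finite union of compact convex
  sets, so the value can be read off from \<open>indicator_INT_UN\<close>.\<close>

lemma intrinsic_volume_INT_UN:
  fixes K :: "'i \<Rightarrow> (real^'n) set" and f :: "'i \<Rightarrow> 'j"
  assumes G: "finite G" and T: "finite T" "T \<noteq> {}" and k: "k \<le> CARD('n)"
    and K: "\<And>i. i \<in> G \<Longrightarrow> compact (K i)" "\<And>i. i \<in> G \<Longrightarrow> convex (K i)"
  shows "intrinsic_volume k (\<Inter>j\<in>T. \<Union>i\<in>{i\<in>G. f i = j}. K i)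
    = (\<Sum>S\<in>{S\<in>Pow G. f ` S = T}. (-1) ^ (card T + card S) * intrinsic_volume_convex k (\<Inter>i\<in>S. K i))"
proof (rule intrinsic_volume_eqI[OF _ _ _ _ k])
  show fin: "finite {S\<in>Pow G. f ` S = T}" using G by simp
  show comp: "compact (\<Inter>i\<in>S. K i)" and conv: "convex (\<Inter>i\<in>S. K i)" if "S \<in> {S\<in>Pow G. f ` S = T}" for S
  proof -
    have "f ` S = T" using that by simp
    then obtain i where i: "i \<in> S" using T(2) by (metis image_is_empty ex_in_conv)
    have "compact (K i \<inter> (\<Inter>i\<in>S. K i))"
      using that i K by (intro compact_Int_closed closed_INT) (auto intro: compact_imp_closed)
    then show "compact (\<Inter>i\<in>S. K i)" using i by (simp add: Int_absorb1 INT_lower)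
    show "convex (\<Inter>i\<in>S. K i)" using that K by (intro convex_INT) auto
  qed
  show "indicator (\<Inter>j\<in>T. \<Union>i\<in>{i\<in>G. f i = j}. K i) x
    = (\<Sum>S\<in>{S\<in>Pow G. f ` S = T}. (-1) ^ (card T + card S) * indicator (\<Inter>i\<in>S. K i) x :: real)" for x
    by (rule indicator_INT_UN[OF G T(1)])
  let ?\<L> = "(\<lambda>S. \<Inter>i\<in>S. K i) ` {S\<in>Pow G. f ` S = T}"
  show "finite ?\<L>" using fin by simp
  show "compact L" "convex L" if "L \<in> ?\<L>" for L using that comp conv by auto
  show "\<Union>?\<L> = (\<Inter>j\<in>T. \<Union>i\<in>{i\<in>G. f i = j}. K i)"
  proof (intro equalityI subsetI)
    fix x assume x: "x \<in> (\<Inter>j\<in>T. \<Union>i\<in>{i\<in>G. f i = j}. K i)"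
    let ?S = "{i\<in>G. f i \<in> T \<and> x \<in> K i}"
    have "f ` ?S = T" using x by fastforce
    then have "?S \<in> {S\<in>Pow G. f ` S = T}" by auto
    then show "x \<in> \<Union>?\<L>" by (rule UnionI[OF imageI]) auto
  next
    fix x assume "x \<in> \<Union>?\<L>"
    then obtain S where "S \<subseteq> G" "f ` S = T" "\<forall>i\<in>S. x \<in> K i" by auto
    then show "x \<in> (\<Inter>j\<in>T. \<Union>i\<in>{i\<in>G. f i = j}. K i)" by fastforce
  qed
qed

section \<open>Grid cubes\<close>

abbreviation (input) grid :: "nat \<Rightarrow> nat \<Rightarrow> ('n::finite \<Rightarrow> nat) set" where
  "grid M n \<equiv> {i. grid_index M n i}"

lemma PiE_UNIV_finite_card:
  fixes A :: "'n::finite \<Rightarrow> 'b set"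
  assumes "\<And>l. finite (A l)"
  shows "finite {i. \<forall>l. i l \<in> A l}" "card {i. \<forall>l. i l \<in> A l} = (\<Prod>l\<in>UNIV. card (A l))"
proof -
  have "{i. \<forall>l. i l \<in> A l} = PiE UNIV A" by (auto simp: PiE_UNIV_domain)
  then show "finite {i. \<forall>l. i l \<in> A l}" "card {i. \<forall>l. i l \<in> A l} = (\<Prod>l\<in>UNIV. card (A l))"
    using assms by (simp_all add: finite_PiE card_PiE)
qed

lemma finite_grid: "finite (grid M n :: ('n::finite \<Rightarrow> nat) set)"
  and card_grid: "card (grid M n :: ('n::finite \<Rightarrow> nat) set) = (M ^ n) ^ CARD('n)"
  using PiE_UNIV_finite_card[of "\<lambda>_::'n. {..<M ^ n}"] by (simp_all add: grid_index_def)

lemma card_grid_slice: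
  "card {i \<in> (grid M n :: ('n::finite \<Rightarrow> nat) set). i l = c} \<le> (M ^ n) ^ (CARD('n) - 1)"
proof -
  let ?A = "\<lambda>m::'n. if m = l then {c} else {..<M ^ n}"
  have "(\<Prod>m\<in>UNIV. card (?A m)) = (\<Prod>m\<in>UNIV - {l}. card (?A m))"
    by (subst prod.remove[of UNIV l]) auto
  also have "\<dots> = (\<Prod>m\<in>UNIV - {l}. M ^ n)" by (intro prod.cong) auto
  also have "\<dots> = (M ^ n) ^ (CARD('n) - 1)" by (simp add: card_Diff_singleton)
  finally have "card {i. \<forall>m. i m \<in> ?A m} = (M ^ n) ^ (CARD('n) - 1)"
    by (subst PiE_UNIV_finite_card(2)) auto
  moreover have "card {i \<in> grid M n. i l = c} \<le> card {i. \<forall>m. i m \<in> ?A m}"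
    by (rule card_mono[OF PiE_UNIV_finite_card(1)]) (auto simp: grid_index_def)
  ultimately show ?thesis by simp
qed

lemma mem_grid_cube: "x \<in> grid_cube M n i \<longleftrightarrow> (\<forall>l. real (i l) / real M ^ n \<le> x $ l \<and> x $ l \<le> real (i l + 1) / real M ^ n)"
  by (simp add: grid_cube_def mem_box_cart)

lemma compact_grid_cube: "compact (grid_cube M n i)" and convex_grid_cube: "convex (grid_cube M n i)"
  by (simp_all add: grid_cube_def convex_box)

text \<open>Used in both orders: indices of meeting cubes differ by at most one in each
  coordinate.\<close>

lemma grid_cube_meet:
  assumes "M > 0" "x \<in> grid_cube M n i" "x \<in> grid_cube M n i'"
  shows "i l \<le> i' l + 1"
proof -
  have "real (i l) / real M ^ n \<le> real (i' l + 1) / real M ^ n"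
    using assms(2,3) unfolding mem_grid_cube by (meson order_trans)
  then have "real (i l) \<le> real (i' l + 1)" using assms(1) by (simp add: divide_le_cancel)
  then show ?thesis by linarith
qed

lemma nat_div_eq_iff: "N > 0 \<Longrightarrow> i div N = j \<longleftrightarrow> j * N \<le> i \<and> i + 1 \<le> (j + 1) * N" for i j N :: nat
  by (auto simp: Suc_le_eq mult.commute dividend_less_times_div intro: div_nat_eqI)

text \<open>On the common scale \<open>M ^ Suc n\<close> the inclusion becomes a statement about
  integer quotients. It turns the geometric condition in \<open>fp_part\<close> into a label of the
  cube.\<close>

lemma grid_cube_subset_iff:
  fixes i j :: "'n::finite \<Rightarrow> nat"
  assumes "M > 0"
  shows "grid_cube M (Suc n) i \<subseteq> grid_cube M 1 j \<longleftrightarrow> ancestor M (Suc n) 1 i = j"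
proof -
  have "grid_cube M (Suc n) i \<subseteq> grid_cube M 1 j \<longleftrightarrow>
    (\<forall>l. real (j l) / real M \<le> real (i l) / real M ^ Suc n \<and> real (i l + 1) / real M ^ Suc n \<le> real (j l + 1) / real M)"
    unfolding grid_cube_def subset_interval_cart(1) using assms by (simp add: divide_right_mono)
  also have "\<dots> \<longleftrightarrow> (\<forall>l. j l * M ^ n \<le> i l \<and> i l + 1 \<le> (j l + 1) * M ^ n)"
  proof -
    have "real c / real M = real (c * M ^ n) / real M ^ Suc n" for c
      using assms by (simp add: field_simps)
    moreover have "real a / real M ^ Suc n \<le> real b / real M ^ Suc n \<longleftrightarrow> a \<le> b" for a b
      using assms zero_less_power[of "real M" "Suc n"] unfolding divide_le_cancel
      by (simp del: power_Suc add: not_less_iff_gr_or_eq)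
    ultimately show ?thesis by (simp only:)
  qed
  also have "\<dots> \<longleftrightarrow> (\<forall>l. i l div M ^ n = j l)"
    using assms by (simp add: nat_div_eq_iff)
  also have "\<dots> \<longleftrightarrow> ancestor M (Suc n) 1 i = j" by (auto simp: ancestor_def fun_eq_iff)
  finally show ?thesis .
qed

section \<open>Self-similarity of the grid\<close>

text \<open>For \<open>i l < M ^ n\<close> this prepends the digit \<open>j l\<close> to the
  base-\<open>M\<close> expansion of \<open>i l\<close>, which places a copy of the
  level-\<open>n\<close> cube \<open>i\<close> in the level-1 cube \<open>j\<close>.\<close>

definition subcube :: "nat \<Rightarrow> ('n \<Rightarrow> nat) \<Rightarrow> nat \<Rightarrow> ('n \<Rightarrow> nat) \<Rightarrow> ('n \<Rightarrow> nat)" where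
  "subcube M j n i = (\<lambda>l. j l * M ^ n + i l)"

lemma inj_subcube: "inj (subcube M j n)"
  by (auto simp: inj_def subcube_def fun_eq_iff)

text \<open>Division by \<open>M ^ (n - m)\<close> only cuts off trailing digits, so the prepended
  digit stays.\<close>

lemma ancestor_subcube:
  assumes "M > 0" "m \<le> n"
  shows "ancestor M (Suc n) (Suc m) (subcube M j n i) = subcube M j m (ancestor M n m i)"
proof
  fix l
  have "M ^ n = M ^ m * M ^ (n - m)" using assms(2) by (simp flip: power_add)
  then have "(j l * M ^ n + i l) div M ^ (n - m) = (i l + (j l * M ^ m) * M ^ (n - m)) div M ^ (n - m)"
    by (simp add: ac_simps)
  also have "\<dots> = j l * M ^ m + i l div M ^ (n - m)" using assms(1) by (subst div_mult_self1) auto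
  finally show "ancestor M (Suc n) (Suc m) (subcube M j n i) l = subcube M j m (ancestor M n m i) l"
    by (simp add: ancestor_def subcube_def)
qed

lemma ancestor_1_subcube:
  assumes "M > 0" "grid_index M n i"
  shows "ancestor M (Suc n) 1 (subcube M j n i) = j"
  using ancestor_subcube[OF assms(1), of 0 n j i] assms(2)
  by (simp add: subcube_def ancestor_def grid_index_def)

lemma grid_index_ancestor:
  assumes "M > 0" "grid_index M n i" "m \<le> n"
  shows "grid_index M m (ancestor M n m i)"
proof -
  have "M ^ n = M ^ m * M ^ (n - m)" using assms(3) by (simp flip: power_add)
  then show ?thesis using assms by (simp add: grid_index_def ancestor_def less_mult_imp_div_less)
qed

lemma subcube_image_grid:
  assumes "M > 0" "grid_index M 1 j"
  shows "subcube M j n ` grid M n = {i \<in> grid M (Suc n). ancestor M (Suc n) 1 i = j}"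
proof (intro equalityI subsetI)
  fix i' assume "i' \<in> subcube M j n ` grid M n"
  then obtain i where i: "grid_index M n i" "i' = subcube M j n i" by auto
  have "j l * M ^ n + i l < M ^ Suc n" for l
  proof -
    have "j l * M ^ n + i l < (j l + 1) * M ^ n" using i(1) by (simp add: grid_index_def)
    also have "\<dots> \<le> M * M ^ n" using assms(2) by (intro mult_right_mono) (auto simp: grid_index_def Suc_le_eq)
    finally show ?thesis by simp
  qed
  then show "i' \<in> {i \<in> grid M (Suc n). ancestor M (Suc n) 1 i = j}"
    using i ancestor_1_subcube[OF assms(1) i(1)] by (simp add: grid_index_def subcube_def)
next
  fix i assume i: "i \<in> {i \<in> grid M (Suc n). ancestor M (Suc n) 1 i = j}"
  then have "j l = i l div M ^ n" for l by (auto simp: ancestor_def)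
  then have "i = subcube M j n (\<lambda>l. i l mod M ^ n)" by (simp add: subcube_def fun_eq_iff div_mult_mod_eq)
  moreover have "grid_index M n (\<lambda>l. i l mod M ^ n)" using assms(1) by (simp add: grid_index_def)
  ultimately show "i \<in> subcube M j n ` grid M n" by blast
qed

lemma grid_cube_subcube:
  fixes i j :: "'n::finite \<Rightarrow> nat"
  assumes "M > 0"
  shows "grid_cube M (Suc n) (subcube M j n i)
    = (\<lambda>x. (\<chi> l. real (j l) / real M) + (1 / real M) *\<^sub>R x) ` grid_cube M n i"
proof -
  let ?a = "\<chi> l. real (i l) / real M ^ n" and ?b = "\<chi> l. real (i l + 1) / real M ^ n" and ?c = "\<chi> l. real (j l) / real M"
  have ne: "cbox ?a ?b \<noteq> {}" using assms by (auto simp: interval_ne_empty_cart divide_right_mono)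
  have "(\<lambda>x. ?c + (1 / real M) *\<^sub>R x) ` grid_cube M n i = (\<lambda>x. (1 / real M) *\<^sub>R x + ?c) ` cbox ?a ?b"
    by (simp add: grid_cube_def add.commute)
  also have "\<dots> = cbox ((1 / real M) *\<^sub>R ?a + ?c) ((1 / real M) *\<^sub>R ?b + ?c)"
    using ne by (subst image_affinity_cbox) auto
  also have "(1 / real M) *\<^sub>R ?a + ?c = (\<chi> l. real (subcube M j n i l) / real M ^ Suc n)"
    using assms by (simp add: vec_eq_iff subcube_def field_simps)
  also have "(1 / real M) *\<^sub>R ?b + ?c = (\<chi> l. real (subcube M j n i l + 1) / real M ^ Suc n)"
    using assms by (simp add: vec_eq_iff subcube_def field_simps)
  finally show ?thesis by (simp add: grid_cube_def)
qed

lemma INT_grid_cube_subcube: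
  fixes S :: "('n::finite \<Rightarrow> nat) set"
  assumes "M > 0" "S \<noteq> {}"
  shows "(\<Inter>i\<in>subcube M j n ` S. grid_cube M (Suc n) i)
    = (\<lambda>x. (\<chi> l. real (j l) / real M) + (1 / real M) *\<^sub>R x) ` (\<Inter>i\<in>S. grid_cube M n i)"
proof -
  let ?f = "\<lambda>x. (\<chi> l. real (j l) / real M) + (1 / real M) *\<^sub>R x"
  have "inj ?f" using assms(1) by (auto simp: inj_def)
  moreover obtain i0 where "i0 \<in> S" using assms(2) by auto
  ultimately have "?f ` (\<Inter>i\<in>S. grid_cube M n i) = (\<Inter>i\<in>S. ?f ` grid_cube M n i)"
    by (intro image_INT[of ?f UNIV]) auto
  then show ?thesis by (simp add: grid_cube_subcube[OF assms(1)])
qed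

lemma compact_INT_grid_cube: "S \<noteq> {} \<Longrightarrow> compact (\<Inter>i\<in>S. grid_cube M n i)"
  and convex_INT_grid_cube: "convex (\<Inter>i\<in>S. grid_cube M n i)"
proof -
  show "compact (\<Inter>i\<in>S. grid_cube M n i)" if "S \<noteq> {}"
  proof -
    from that obtain i where i: "i \<in> S" by auto
    have "compact (grid_cube M n i \<inter> (\<Inter>i\<in>S. grid_cube M n i))"
      by (intro compact_Int_closed closed_INT compact_grid_cube ballI compact_imp_closed)
    then show ?thesis using i by (simp add: Int_absorb1 INT_lower)
  qed
  show "convex (\<Inter>i\<in>S. grid_cube M n i)" by (intro convex_INT convex_grid_cube)
qed

text \<open>A nonempty intersection of grid cubes is a face of a cube, so up to translation and scaling there
  are only finitely many of them.\<close>
lemma intrinsic_volume_INT_grid_cube_bound: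
  fixes M :: nat
  assumes "M > 0" "k \<le> CARD('n::finite)"
  obtains C where "C \<ge> 0"
    "\<And>n (S :: ('n \<Rightarrow> nat) set). finite S \<Longrightarrow> S \<noteq> {} \<Longrightarrow>
       \<bar>intrinsic_volume_convex k (\<Inter>i\<in>S. grid_cube M n i)\<bar> \<le> C * (1 / real M ^ n) ^ k"
proof
  \<comment> \<open>The finitely many shapes: \<open>Q B\<close> is the face of the unit cube
    spanned by the directions in \<open>B\<close>.\<close>
  define Q :: "'n set \<Rightarrow> (real^'n) set" where "Q B = cbox 0 (\<chi> l. if l \<in> B then 1 else 0)" for B
  let ?C = "\<Sum>B\<in>UNIV. \<bar>intrinsic_volume_convex k (Q B)\<bar>"
  show "?C \<ge> 0" by (intro sum_nonneg) auto
  fix n and S :: "('n \<Rightarrow> nat) set"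
  assume S: "finite S" "S \<noteq> {}"
  let ?N = "real M ^ n"
  have N: "?N > 0" using assms(1) by simp
  show "\<bar>intrinsic_volume_convex k (\<Inter>i\<in>S. grid_cube M n i)\<bar> \<le> ?C * (1 / ?N) ^ k"
  proof (cases "(\<Inter>i\<in>S. grid_cube M n i) = {}")
    case True
    then show ?thesis using \<open>?C \<ge> 0\<close> by (simp add: intrinsic_volume_convex_def)
  next
    case False
    then obtain x where x: "\<And>i. i \<in> S \<Longrightarrow> x \<in> grid_cube M n i" by auto
    \<comment> \<open>In units of the side length, the intersection is the box from the largest
      lower corner \<open>a\<close> to the smallest upper corner \<open>b\<close>.\<close>
    define a where "a l = Max ((\<lambda>i. i l) ` S)" for l
    define b where "b l = Min ((\<lambda>i. i l) ` S) + 1" for l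
    have a: "\<exists>i\<in>S. i l = a l" and b: "\<exists>i\<in>S. i l + 1 = b l" for l
    proof -
      have "finite ((\<lambda>i. i l) ` S)" "(\<lambda>i. i l) ` S \<noteq> {}" using S by auto
      from Max_in[OF this] Min_in[OF this] obtain i i' where "i \<in> S" "a l = i l" "i' \<in> S" "Min ((\<lambda>i. i l) ` S) = i' l"
        unfolding a_def by (elim imageE)
      then have "i \<in> S \<and> i l = a l" "i' \<in> S \<and> i' l + 1 = b l" by (simp_all add: b_def)
      then show "\<exists>i\<in>S. i l = a l" "\<exists>i\<in>S. i l + 1 = b l" by blast+
    qed
    have le: "i l \<le> a l" "b l \<le> i l + 1" if "i \<in> S" for i l
      using that S by (auto simp: a_def b_def)
    \<comment> \<open>Each side of this box has length 0 or 1: a common point forces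
      \<open>a l \<le> b l\<close>, and any single cube bounds the length by 1.\<close>
    have ab: "a l \<le> b l" "b l \<le> a l + 1" for l
    proof -
      obtain i i' where "i \<in> S" "i l = a l" "i' \<in> S" "i' l + 1 = b l" using a b by meson
      then show "a l \<le> b l" "b l \<le> a l + 1"
        using grid_cube_meet[OF assms(1) x x, of i i' l] le[of i l] by auto
    qed
    have mem: "y \<in> (\<Inter>i\<in>S. grid_cube M n i) \<longleftrightarrow> (\<forall>l. real (a l) \<le> ?N * y $ l \<and> ?N * y $ l \<le> real (b l))" for y
    proof -
      have "y \<in> (\<Inter>i\<in>S. grid_cube M n i) \<longleftrightarrow> (\<forall>l. \<forall>i\<in>S. real (i l) \<le> ?N * y $ l \<and> ?N * y $ l \<le> real (i l + 1))"
        using N by (auto simp: mem_grid_cube field_simps)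
      also have "\<dots> \<longleftrightarrow> (\<forall>l. real (a l) \<le> ?N * y $ l \<and> ?N * y $ l \<le> real (b l))"
      proof (intro all_cong1)
        fix l
        obtain i i' where "i \<in> S" "i l = a l" "i' \<in> S" "i' l + 1 = b l" using a b by meson
        moreover have "real (i l) \<le> real (a l)" "real (b l) \<le> real (i l + 1)" if "i \<in> S" for i
          using le[OF that, of l] by (simp_all only: of_nat_le_iff)
        ultimately show "(\<forall>i\<in>S. real (i l) \<le> ?N * y $ l \<and> ?N * y $ l \<le> real (i l + 1))
            \<longleftrightarrow> real (a l) \<le> ?N * y $ l \<and> ?N * y $ l \<le> real (b l)"
          by (metis order_trans)
      qed
      finally show ?thesis .
    qed
    define B where "B = {l. b l = a l + 1}"
    have bB: "real (b l) = real (a l) + (if l \<in> B then 1 else 0)" for l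
      using ab[of l] by (auto simp: B_def)
    let ?f = "\<lambda>x. (\<chi> l. real (a l) / ?N) + (1 / ?N) *\<^sub>R x"
    have "(\<Inter>i\<in>S. grid_cube M n i) = ?f ` Q B"
    proof (intro equalityI subsetI)
      fix y assume y: "y \<in> (\<Inter>i\<in>S. grid_cube M n i)"
      let ?z = "\<chi> l. ?N * y $ l - real (a l)"
      have "?z \<in> Q B" using y bB unfolding mem Q_def mem_box_cart by (auto simp: algebra_simps)
      moreover have "y = ?f ?z" using N by (simp add: vec_eq_iff field_simps)
      ultimately show "y \<in> ?f ` Q B" by blast
    next
      fix y assume "y \<in> ?f ` Q B"
      then obtain z where "z \<in> Q B" "y = ?f z" by blast
      then show "y \<in> (\<Inter>i\<in>S. grid_cube M n i)" using N bB
        unfolding mem Q_def mem_box_cart by (simp add: distrib_left)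
    qed
    then have "intrinsic_volume_convex k (\<Inter>i\<in>S. grid_cube M n i) = (1 / ?N) ^ k * intrinsic_volume_convex k (Q B)"
      using N assms(2) by (simp only:) (intro intrinsic_volume_convex_homothety, auto simp: Q_def convex_box)
    moreover have "\<bar>intrinsic_volume_convex k (Q B)\<bar> \<le> ?C"
      by (rule member_le_sum) auto
    ultimately show ?thesis using N by (simp add: abs_mult mult.commute mult_right_mono)
  qed
qed

text \<open>The coins that decide whether all level-\<open>n\<close> cubes in \<open>S\<close> survive.\<close>
definition coins :: "nat \<Rightarrow> nat \<Rightarrow> ('n \<Rightarrow> nat) set \<Rightarrow> (nat \<times> ('n \<Rightarrow> nat)) set" where
  "coins M n S = (\<lambda>(m, i). (m, ancestor M n m i)) ` ({1..n} \<times> S)"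

lemma mem_coins: "(m, c) \<in> coins M n S \<longleftrightarrow> m \<in> {1..n} \<and> (\<exists>i\<in>S. c = ancestor M n m i)"
  by (auto simp: coins_def)

lemma finite_coins: "finite S \<Longrightarrow> finite (coins M n S)"
  by (simp add: coins_def)

text \<open>All these cubes share the level-1 coin of \<open>j\<close>; the other coins correspond
  to those of \<open>S\<close>, moved to the next level.\<close>

lemma card_coins_subcube:
  assumes "M > 0" "S \<noteq> {}" "S \<subseteq> grid M n"
  shows "card (coins M (Suc n) (subcube M j n ` S)) = Suc (card (coins M n S))"
proof -
  have S: "finite S" using assms(3) finite_grid finite_subset by blast
  let ?g = "\<lambda>(m, c). (Suc m, subcube M j m c)"
  have "coins M (Suc n) (subcube M j n ` S) = insert (1, j) (?g ` coins M n S)"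
  proof (intro equalityI subsetI)
    fix z assume "z \<in> coins M (Suc n) (subcube M j n ` S)"
    then obtain m i where z: "z = (m, ancestor M (Suc n) m (subcube M j n i))" "m \<in> {1..Suc n}" "i \<in> S"
      by (auto simp: coins_def)
    show "z \<in> insert (1, j) (?g ` coins M n S)"
    proof (cases "m = 1")
      case True
      then show ?thesis using z ancestor_1_subcube[OF assms(1)] assms(3) by auto
    next
      case False
      then obtain m' where m': "m = Suc m'" "m' \<in> {1..n}" using z(2) by (cases m) auto
      then have "z = ?g (m', ancestor M n m' i)" using z(1) ancestor_subcube[OF assms(1)] by auto
      moreover have "(m', ancestor M n m' i) \<in> coins M n S" using m' z(3) by (auto simp: mem_coins)
      ultimately show ?thesis by blast
    qed
  next
    fix z assume "z \<in> insert (1, j) (?g ` coins M n S)"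
    then consider "z = (1, j)" | m i where "m \<in> {1..n}" "i \<in> S" "z = (Suc m, subcube M j m (ancestor M n m i))"
      by (auto simp: coins_def)
    then show "z \<in> coins M (Suc n) (subcube M j n ` S)"
    proof cases
      case 1
      obtain i where "i \<in> S" using assms(2) by auto
      moreover from this have "ancestor M (Suc n) 1 (subcube M j n i) = j"
        using ancestor_1_subcube[OF assms(1)] assms(3) by auto
      ultimately show ?thesis using 1 by (force simp: mem_coins)
    next
      case 2
      then have "z = (Suc m, ancestor M (Suc n) (Suc m) (subcube M j n i))"
        using ancestor_subcube[OF assms(1), of m n j i] by simp
      moreover have "(Suc m, ancestor M (Suc n) (Suc m) (subcube M j n i)) \<in> coins M (Suc n) (subcube M j n ` S)"
        using 2 unfolding mem_coins by auto
      ultimately show ?thesis by simp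
    qed
  qed
  moreover have "(1, j) \<notin> ?g ` coins M n S" by (auto simp: mem_coins)
  moreover have "inj_on ?g (coins M n S)"
    by (auto simp: inj_on_def dest: injD[OF inj_subcube])
  ultimately show ?thesis using finite_coins[OF S] by (simp add: card_image)
qed

text \<open>Different level-1 ancestors force different ancestors on every later level, so each of
  the \<open>Suc n\<close> levels has at least two coins.\<close>

lemma card_coins_ge:
  assumes "finite S" "i \<in> S" "i' \<in> S" "ancestor M (Suc n) 1 i \<noteq> ancestor M (Suc n) 1 i'"
  shows "2 * Suc n \<le> card (coins M (Suc n) S)"
proof -
  let ?g = "\<lambda>m. (m, ancestor M (Suc n) m i)" and ?g' = "\<lambda>m. (m, ancestor M (Suc n) m i')"
  have anc: "ancestor M (Suc n) 1 i l = ancestor M (Suc n) m i l div M ^ (m - 1)" if "m \<in> {1..Suc n}" for i m l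
  proof -
    have "M ^ n = M ^ (Suc n - m) * M ^ (m - 1)" using that by (simp flip: power_add)
    then show ?thesis by (simp add: ancestor_def div_mult2_eq)
  qed
  have "?g ` {1..Suc n} \<inter> ?g' ` {1..Suc n} = {}"
  proof -
    have "ancestor M (Suc n) m i \<noteq> ancestor M (Suc n) m i'" if "m \<in> {1..Suc n}" for m
      using assms(4) anc[OF that, of i] anc[OF that, of i'] by auto
    then show ?thesis by auto
  qed
  moreover have "card (?g ` {1..Suc n}) = Suc n" "card (?g' ` {1..Suc n}) = Suc n"
    by (simp_all add: card_image inj_on_def)
  ultimately have "2 * Suc n = card (?g ` {1..Suc n} \<union> ?g' ` {1..Suc n})"
    by (subst card_Un_disjoint) auto
  also have "\<dots> \<le> card (coins M (Suc n) S)"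
    using assms(1-3) by (intro card_mono finite_coins) (auto simp: coins_def)
  finally show ?thesis .
qed

text \<open>Cubes in different level-1 cubes \<open>j\<close>, \<open>j'\<close> can only meet along a common face, which restricts
  one coordinate of the cube in \<open>j\<close> to a single value.\<close>
lemma card_intersecting_families:
  fixes T :: "('n::finite \<Rightarrow> nat) set"
  assumes "M > 0" "j \<in> T" "j' \<in> T" "j \<noteq> j'"
  shows "card {S \<in> Pow (grid M (Suc n)). ancestor M (Suc n) 1 ` S = T \<and> (\<Inter>i\<in>S. grid_cube M (Suc n) i) \<noteq> {}}
    \<le> (M ^ Suc n) ^ (CARD('n) - 1) * 2 ^ (3 ^ CARD('n))"
proof -
  obtain l where l: "j l \<noteq> j' l" using assms(4) by auto
  \<comment> \<open>In direction \<open>l\<close>, this is the last index inside \<open>j\<close> if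
    \<open>j'\<close> lies above \<open>j\<close>, and the first one otherwise.\<close>
  define c where "c = (if j l < j' l then (j l + 1) * M ^ n - 1 else j l * M ^ n)"
  define A where "A i = {i' :: 'n \<Rightarrow> nat. \<forall>l. i' l \<in> {i l - 1..i l + 1}}" for i
  let ?I = "{i \<in> grid M (Suc n). i l = c}"
  have finA: "finite (A i)" and cardA: "card (A i) \<le> 3 ^ CARD('n)" for i
  proof -
    show "finite (A i)" unfolding A_def by (rule PiE_UNIV_finite_card) simp
    have "card (A i) = (\<Prod>l\<in>UNIV. card {i l - 1..i l + 1})"
      unfolding A_def by (rule PiE_UNIV_finite_card) simp
    also have "\<dots> \<le> (\<Prod>l\<in>(UNIV :: 'n set). 3)" by (intro prod_mono) auto
    finally show "card (A i) \<le> 3 ^ CARD('n)" by simp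
  qed
  have finI: "finite ?I" using finite_grid by (rule rev_finite_subset) auto
  \<comment> \<open>Some member \<open>i\<close> of \<open>S\<close> lies in \<open>j\<close> and
    hence in the slice \<open>?I\<close>; all members meet \<open>i\<close>, so \<open>S\<close> is
    a subset of its neighbourhood \<open>A i\<close>.\<close>
  have "{S \<in> Pow (grid M (Suc n)). ancestor M (Suc n) 1 ` S = T \<and> (\<Inter>i\<in>S. grid_cube M (Suc n) i) \<noteq> {}}
      \<subseteq> (\<Union>i\<in>?I. Pow (A i))"
  proof
    fix S assume "S \<in> {S \<in> Pow (grid M (Suc n)). ancestor M (Suc n) 1 ` S = T \<and> (\<Inter>i\<in>S. grid_cube M (Suc n) i) \<noteq> {}}"
    then obtain x where S: "S \<subseteq> grid M (Suc n)" "ancestor M (Suc n) 1 ` S = T"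
      and x: "\<And>i. i \<in> S \<Longrightarrow> x \<in> grid_cube M (Suc n) i" by auto
    obtain i i' where i: "i \<in> S" "ancestor M (Suc n) 1 i = j" and i': "i' \<in> S" "ancestor M (Suc n) 1 i' = j'"
      using S(2) assms(2,3) by (metis imageE)
    have near: "i1 m \<le> i2 m + 1" if "i1 \<in> S" "i2 \<in> S" for i1 i2 m
      by (rule grid_cube_meet[OF assms(1) x[OF that(1)] x[OF that(2)]])
    have dj: "i l div M ^ n = j l" "i' l div M ^ n = j' l"
      using i(2) i'(2) by (auto simp: ancestor_def)
    have N: "M ^ n > 0" using assms(1) by simp
    have bnd: "j l * M ^ n \<le> i l" "i l < (j l + 1) * M ^ n" "j' l * M ^ n \<le> i' l" "i' l < (j' l + 1) * M ^ n"
      using dj by (auto simp: nat_div_eq_iff[OF N] Suc_le_eq)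
    have "i l = c"
    proof (cases "j l < j' l")
      case True
      then have "(j l + 1) * M ^ n \<le> j' l * M ^ n" by (intro mult_right_mono) auto
      then show ?thesis using True bnd near[OF i'(1) i(1), of l] by (simp add: c_def)
    next
      case False
      then have "(j' l + 1) * M ^ n \<le> j l * M ^ n" using l by (intro mult_right_mono) auto
      then show ?thesis using False bnd near[OF i(1) i'(1), of l] by (simp add: c_def)
    qed
    moreover have "S \<subseteq> A i"
    proof
      fix i2 assume "i2 \<in> S"
      then have "i l \<le> i2 l + 1" "i2 l \<le> i l + 1" for l using near[OF i(1)] near[OF _ i(1)] by auto
      then show "i2 \<in> A i" by (auto simp: A_def intro: le_diff_conv[THEN iffD2])
    qed
    ultimately show "S \<in> (\<Union>i\<in>?I. Pow (A i))" using i(1) S(1) by auto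
  qed
  then have "card {S \<in> Pow (grid M (Suc n)). ancestor M (Suc n) 1 ` S = T \<and> (\<Inter>i\<in>S. grid_cube M (Suc n) i) \<noteq> {}}
      \<le> card (\<Union>i\<in>?I. Pow (A i))"
    using finI finA by (intro card_mono) auto
  also have "\<dots> \<le> (\<Sum>i\<in>?I. card (Pow (A i)))" by (rule card_UN_le[OF finI])
  also have "\<dots> \<le> (\<Sum>i\<in>?I. 2 ^ (3 ^ CARD('n)))"
    using finA cardA by (intro sum_mono) (simp add: card_Pow power_increasing)
  also have "\<dots> = card ?I * 2 ^ (3 ^ CARD('n))" by simp
  also have "\<dots> \<le> (M ^ Suc n) ^ (CARD('n) - 1) * 2 ^ (3 ^ CARD('n))"
    by (rule mult_right_mono[OF card_grid_slice]) simp
  finally show ?thesis .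
qed

section \<open>Expected intrinsic volumes\<close>

locale fractal_percolation = prob_space P
  for P :: "'w measure" +
  fixes X :: "nat \<Rightarrow> ('n::finite \<Rightarrow> nat) \<Rightarrow> 'w \<Rightarrow> bool" and M :: nat and p :: real and k :: nat
  assumes M: "M \<ge> 2" and p: "0 < p" "p \<le> 1" and k: "k \<le> CARD('n)"
    and indep: "indep_vars (\<lambda>_. count_space UNIV) (\<lambda>(n, i). X n i) {(n, i). 1 \<le> n \<and> grid_index M n i}"
    and prob_X: "\<And>n i. 1 \<le> n \<Longrightarrow> grid_index M n i \<Longrightarrow> prob {w \<in> space P. X n i w} = p"
begin

definition survivors :: "nat \<Rightarrow> 'w \<Rightarrow> ('n \<Rightarrow> nat) set" where
  "survivors n w = {i. grid_index M n i \<and> fp_survives M X n i w}"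

definition vol :: "nat \<Rightarrow> ('n \<Rightarrow> nat) set \<Rightarrow> real" where
  "vol n S = intrinsic_volume_convex k (\<Inter>i\<in>S. grid_cube M n i)"

definition survival :: "nat \<Rightarrow> ('n \<Rightarrow> nat) set \<Rightarrow> 'w set" where
  "survival n S = {w \<in> space P. S \<subseteq> survivors n w}"

text \<open>\<open>S\<close> survives when all coins in \<open>coins M n S\<close> succeed. As a
  set, it counts shared ancestors only once, so independence gives the right power of
  \<open>p\<close>.\<close>

lemma survival:
  assumes "S \<subseteq> grid M n"
  shows "survival n S \<in> events" "prob (survival n S) = p ^ card (coins M n S)"
proof -
  let ?J = "coins M n S"
  let ?Y = "\<lambda>(m, c). X m c"
  let ?E = "\<lambda>z. ?Y z -` {True} \<inter> space P"
  have fin: "finite ?J" using assms finite_grid finite_subset finite_coins by metis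
  have sub: "?J \<subseteq> {(n, i). 1 \<le> n \<and> grid_index M n i}"
    using assms M by (auto simp: mem_coins intro!: grid_index_ancestor[of M n])
  have rv: "?E z \<in> events" if "z \<in> ?J" for z
  proof -
    have "random_variable (count_space UNIV) (?Y z)" using indep sub that unfolding indep_vars_def by auto
    then show ?thesis by (rule measurable_sets) simp
  qed
  have "survival n S \<in> events \<and> prob (survival n S) = p ^ card ?J"
  proof (cases "?J = {}")
    \<comment> \<open>Without coins the event is the whole space; this case is separate because the
      product rule \<open>indep_varsD\<close> asks for a nonempty index set.\<close>
    case True
    then have "n = 0 \<or> S = {}" by (auto simp: coins_def)
    then have "survival n S = space P"
      using assms by (auto simp: survival_def survivors_def fp_survives_def)
    then show ?thesis using True prob_space by simp
  next
    case False
    have "survival n S = (\<Inter>z\<in>?J. ?E z)"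
    proof (intro equalityI subsetI)
      fix w assume w: "w \<in> (\<Inter>z\<in>?J. ?E z)"
      have "X m (ancestor M n m i) w" if "m \<in> {1..n}" "i \<in> S" for m i
      proof -
        have "(m, ancestor M n m i) \<in> ?J" using that by (auto simp: mem_coins)
        then have "w \<in> ?E (m, ancestor M n m i)" using w by blast
        then show ?thesis by simp
      qed
      moreover have "w \<in> space P" using w False by auto
      ultimately show "w \<in> survival n S"
        using assms by (auto simp: survival_def survivors_def fp_survives_def)
    next
      fix w assume "w \<in> survival n S"
      then show "w \<in> (\<Inter>z\<in>?J. ?E z)"
        by (auto simp: survival_def survivors_def fp_survives_def coins_def)
    qed
    moreover have "prob (\<Inter>z\<in>?J. ?E z) = (\<Prod>z\<in>?J. prob (?E z))"
      by (rule indep_varsD[OF indep False fin sub]) simp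
    moreover have "prob (?E z) = p" if z: "z \<in> ?J" for z
    proof -
      obtain m c where mc: "z = (m, c)" by (cases z)
      have "?E z = {w \<in> space P. X m c w}" by (auto simp: mc)
      then show ?thesis using prob_X[of m c] sub z mc by auto
    qed
    moreover have "(\<Inter>z\<in>?J. ?E z) \<in> events"
      using fin False rv by (intro sets.finite_INT) auto
    ultimately show ?thesis by simp
  qed
  then show "survival n S \<in> events" "prob (survival n S) = p ^ card ?J" by auto
qed

text \<open>Moving the randomness from the range of summation into indicators leaves a fixed finite
  sum, which can be integrated term by term.\<close>

lemma intrinsic_volume_labelled:
  fixes f :: "('n \<Rightarrow> nat) \<Rightarrow> 'j"
  assumes "finite T" "T \<noteq> {}" "w \<in> space P"
  shows "intrinsic_volume k (\<Inter>j\<in>T. \<Union>i\<in>{i\<in>survivors n w. f i = j}. grid_cube M n i)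
    = (\<Sum>S\<in>{S\<in>Pow (grid M n). f ` S = T}. (-1) ^ (card T + card S) * vol n S * indicator (survival n S) w)"
proof -
  have sub: "survivors n w \<subseteq> grid M n" by (auto simp: survivors_def)
  then have fin: "finite (survivors n w)" using finite_grid finite_subset by blast
  have "intrinsic_volume k (\<Inter>j\<in>T. \<Union>i\<in>{i\<in>survivors n w. f i = j}. grid_cube M n i)
    = (\<Sum>S\<in>{S\<in>Pow (survivors n w). f ` S = T}. (-1) ^ (card T + card S) * vol n S)"
    unfolding vol_def
    by (rule intrinsic_volume_INT_UN[OF fin assms(1,2) k compact_grid_cube convex_grid_cube])
  also have "\<dots> = (\<Sum>S\<in>{S\<in>Pow (grid M n). f ` S = T}. (-1) ^ (card T + card S) * vol n S * indicator (survival n S) w)"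
    using sub assms(3) finite_grid[of M n]
    by (intro sum.mono_neutral_cong_left) (auto simp: survival_def indicator_def)
  finally show ?thesis .
qed

lemma expectation_labelled:
  fixes f :: "('n \<Rightarrow> nat) \<Rightarrow> 'j"
  assumes "finite T" "T \<noteq> {}"
    and A: "\<And>w. w \<in> space P \<Longrightarrow> A w = (\<Inter>j\<in>T. \<Union>i\<in>{i\<in>survivors n w. f i = j}. grid_cube M n i)"
  shows "expectation (\<lambda>w. intrinsic_volume k (A w))
    = (\<Sum>S\<in>{S\<in>Pow (grid M n). f ` S = T}. (-1) ^ (card T + card S) * vol n S * p ^ card (coins M n S))"
proof -
  have "expectation (\<lambda>w. intrinsic_volume k (A w))
    = expectation (\<lambda>w. \<Sum>S\<in>{S\<in>Pow (grid M n). f ` S = T}. (-1) ^ (card T + card S) * vol n S * indicator (survival n S) w)"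
    using A intrinsic_volume_labelled[OF assms(1,2)] by (intro Bochner_Integration.integral_cong) auto
  also have "\<dots> = (\<Sum>S\<in>{S\<in>Pow (grid M n). f ` S = T}. expectation (\<lambda>w. (-1) ^ (card T + card S) * vol n S * indicator (survival n S) w))"
    using survival(1) by (intro Bochner_Integration.integral_sum integrable_mult_right integrable_real_indicator)
      (auto simp: emeasure_eq_measure)
  also have "\<dots> = (\<Sum>S\<in>{S\<in>Pow (grid M n). f ` S = T}. (-1) ^ (card T + card S) * vol n S * p ^ card (coins M n S))"
    using survival by (intro sum.cong refl) (auto simp: Int_absorb2 sets.sets_into_space)
  finally show ?thesis .
qed

definition EV :: "nat \<Rightarrow> real" where
  "EV n = expectation (\<lambda>w. intrinsic_volume k (fp_step M X n w))"

definition ET :: "nat \<Rightarrow> ('n \<Rightarrow> nat) set \<Rightarrow> real" where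
  "ET n T = expectation (\<lambda>w. intrinsic_volume k (\<Inter>j\<in>T. fp_part M X j n w))"

text \<open>With one label for all cubes, \<open>expectation_labelled\<close> is inclusion-exclusion
  for their union.\<close>

lemma EV_eq: "EV n = (\<Sum>S\<in>Pow (grid M n) - {{}}. (-1) ^ (1 + card S) * vol n S * p ^ card (coins M n S))"
proof -
  have "EV n = (\<Sum>S\<in>{S\<in>Pow (grid M n). (\<lambda>_. ()) ` S = {()}}. (-1) ^ (card {()} + card S) * vol n S * p ^ card (coins M n S))"
    unfolding EV_def by (rule expectation_labelled) (auto simp: fp_step_def survivors_def)
  also have "{S\<in>Pow (grid M n). (\<lambda>_. ()) ` S = {()}} = Pow (grid M n) - {{}}" by auto
  finally show ?thesis by simp
qed

text \<open>The label of a cube is its level-1 ancestor; the level is \<open>Suc n\<close> because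
  cubes lie in level-1 cubes only from level 1 on.\<close>

lemma ET_eq:
  assumes "T \<noteq> {}" "finite T"
  shows "ET (Suc n) T = (\<Sum>S\<in>{S\<in>Pow (grid M (Suc n)). ancestor M (Suc n) 1 ` S = T}.
    (-1) ^ (card T + card S) * vol (Suc n) S * p ^ card (coins M (Suc n) S))"
  unfolding ET_def
proof (rule expectation_labelled[OF assms(2,1)])
  have "M > 0" using M by simp
  have "fp_part M X j (Suc n) w = (\<Union>i\<in>{i\<in>survivors (Suc n) w. ancestor M (Suc n) 1 i = j}. grid_cube M (Suc n) i)" for j w
    unfolding fp_part_def survivors_def grid_cube_subset_iff[OF \<open>M > 0\<close>] by blast
  then show "(\<Inter>j\<in>T. fp_part M X j (Suc n) w)
      = (\<Inter>j\<in>T. \<Union>i\<in>{i\<in>survivors (Suc n) w. ancestor M (Suc n) 1 i = j}. grid_cube M (Suc n) i)" for w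
    by (simp only:)
qed

text \<open>A part \<open>F_n^j\<close> that survives the first step is a copy of \<open>F_{n-1}\<close> scaled by \<open>1/M\<close>.\<close>
lemma ET_single:
  assumes j: "grid_index M 1 j"
  shows "ET (Suc n) {j} = p * (1 / real M) ^ k * EV n"
proof -
  have M0: "M > 0" using M by simp
  let ?s = "subcube M j n"
  let ?g = "\<lambda>n S. (-1) ^ (1 + card S) * vol n S * p ^ card (coins M n S)"
  have "{S\<in>Pow (grid M (Suc n)). ancestor M (Suc n) 1 ` S = {j}} = (`) ?s ` (Pow (grid M n) - {{}})"
  proof -
    have "{S\<in>Pow (grid M (Suc n)). ancestor M (Suc n) 1 ` S = {j}} = Pow (?s ` grid M n) - {{}}"
      unfolding subcube_image_grid[OF M0 j] by auto
    also have "\<dots> = (`) ?s ` (Pow (grid M n) - {{}})"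
      by (auto simp: image_Pow_surj[OF refl, symmetric])
    finally show ?thesis .
  qed
  then have "ET (Suc n) {j} = (\<Sum>S\<in>(`) ?s ` (Pow (grid M n) - {{}}). ?g (Suc n) S)"
    by (subst ET_eq) auto
  also have "\<dots> = (\<Sum>S\<in>Pow (grid M n) - {{}}. ?g (Suc n) (?s ` S))"
    by (subst sum.reindex) (auto simp: inj_on_def inj_image_eq_iff[OF inj_subcube])
  \<comment> \<open>Scaling by \<open>1 / real M\<close> gives the power of
    \<open>1 / real M\<close>, and the coin of \<open>j\<close> gives the additional factor
    \<open>p\<close>.\<close>
  also have "\<dots> = (\<Sum>S\<in>Pow (grid M n) - {{}}. p * (1 / real M) ^ k * ?g n S)"
  proof (intro sum.cong refl)
    fix S :: "('n \<Rightarrow> nat) set" assume "S \<in> Pow (grid M n) - {{}}"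
    then have S: "S \<noteq> {}" "S \<subseteq> grid M n" by auto
    have "vol (Suc n) (?s ` S) = (1 / real M) ^ k * vol n S"
      unfolding vol_def INT_grid_cube_subcube[OF M0 S(1)]
      by (rule intrinsic_volume_convex_homothety[OF compact_INT_grid_cube[OF S(1)] convex_INT_grid_cube _ k])
        (use M0 in simp)
    moreover have "card (?s ` S) = card S"
      by (rule card_image[OF inj_on_subset[OF inj_subcube]]) simp
    ultimately show "?g (Suc n) (?s ` S) = p * (1 / real M) ^ k * ?g n S"
      using card_coins_subcube[OF M0 S, of j] by simp
  qed
  also have "\<dots> = p * (1 / real M) ^ k * EV n" unfolding EV_eq by (rule sum_distrib_left[symmetric])
  finally show ?thesis .
qed

text \<open>The families in \<open>EV_eq\<close> are grouped by their set \<open>T\<close> of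
  level-1 ancestors. The \<open>real M ^ CARD('n)\<close> singletons \<open>T\<close> give the
  multiple of \<open>EV n\<close> through \<open>ET_single\<close>.\<close>

lemma EV_Suc:
  "EV (Suc n) = real M ^ CARD('n) * p * (1 / real M) ^ k * EV n
    + (\<Sum>T\<in>{T. T \<subseteq> grid M 1 \<and> card T \<ge> 2}. (-1) ^ (card T - 1) * ET (Suc n) T)"
proof -
  let ?g = "\<lambda>S. (-1) ^ (1 + card S) * vol (Suc n) S * p ^ card (coins M (Suc n) S)"
  let ?anc = "ancestor M (Suc n) 1"
  let ?\<T> = "Pow (grid M 1) - {{}} :: ('n \<Rightarrow> nat) set set"
  have fin: "finite (Pow (grid M n) - {{}} :: ('n \<Rightarrow> nat) set set)" for n using finite_grid by auto
  have M0: "M > 0" using M by simp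
  have finT: "finite T" if "T \<subseteq> grid M 1" for T :: "('n \<Rightarrow> nat) set"
    using that finite_grid finite_subset by blast
  have "EV (Suc n) = (\<Sum>T\<in>?\<T>. \<Sum>S\<in>{S\<in>Pow (grid M (Suc n)) - {{}}. ?anc ` S = T}. ?g S)"
    unfolding EV_eq
  proof (rule sum.group[OF fin fin, symmetric])
    show "(`) ?anc ` (Pow (grid M (Suc n)) - {{}}) \<subseteq> ?\<T>"
      using grid_index_ancestor[OF M0, of "Suc n" _ 1] by auto
  qed
  also have "\<dots> = (\<Sum>T\<in>?\<T>. (-1) ^ (1 + card T) * ET (Suc n) T)"
  proof (intro sum.cong refl)
    fix T assume T: "T \<in> ?\<T>"
    then have "{S\<in>Pow (grid M (Suc n)) - {{}}. ?anc ` S = T} = {S\<in>Pow (grid M (Suc n)). ?anc ` S = T}" by auto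
    moreover have "(-1) ^ (1 + card T) * ET (Suc n) T = (\<Sum>S\<in>{S\<in>Pow (grid M (Suc n)). ?anc ` S = T}. ?g S)"
    proof -
      have "(-1::real) ^ (1 + card T) * (-1) ^ (card T + card S) = (-1) ^ (1 + card S)" for S :: "('n \<Rightarrow> nat) set"
        by (simp add: power_add mult.assoc[symmetric] flip: power_mult_distrib)
      then show ?thesis using T finT
        by (subst ET_eq) (auto simp: sum_distrib_left mult.assoc[symmetric] intro!: sum.cong)
    qed
    ultimately show "(\<Sum>S\<in>{S\<in>Pow (grid M (Suc n)) - {{}}. ?anc ` S = T}. ?g S) = (-1) ^ (1 + card T) * ET (Suc n) T"
      by simp
  qed
  also have "\<dots> = (\<Sum>T\<in>{T\<in>?\<T>. card T = 1}. (-1) ^ (1 + card T) * ET (Suc n) T)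
      + (\<Sum>T\<in>{T\<in>?\<T>. card T \<ge> 2}. (-1) ^ (1 + card T) * ET (Suc n) T)"
  proof (subst sum.union_disjoint[symmetric])
    have "card T = 1 \<or> card T \<ge> 2" if "T \<in> ?\<T>" for T
    proof -
      have "card T > 0" using that finT by (auto simp: card_gt_0_iff)
      then show ?thesis by linarith
    qed
    then show "(\<Sum>T\<in>?\<T>. (-1) ^ (1 + card T) * ET (Suc n) T)
      = (\<Sum>T\<in>{T\<in>?\<T>. card T = 1} \<union> {T\<in>?\<T>. card T \<ge> 2}. (-1) ^ (1 + card T) * ET (Suc n) T)"
      by (intro sum.cong) auto
  qed (use fin in auto)
  also have "(\<Sum>T\<in>{T\<in>?\<T>. card T = 1}. (-1) ^ (1 + card T) * ET (Suc n) T) = (\<Sum>j\<in>grid M 1. ET (Suc n) {j})"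
  proof -
    have "{T\<in>?\<T>. card T = 1} = (\<lambda>j. {j}) ` grid M 1" by (auto simp: card_1_singleton_iff)
    then show ?thesis by (simp add: sum.reindex)
  qed
  also have "\<dots> = (\<Sum>j\<in>(grid M 1 :: ('n \<Rightarrow> nat) set). p * (1 / real M) ^ k * EV n)"
    by (intro sum.cong refl ET_single) simp
  also have "\<dots> = real M ^ CARD('n) * p * (1 / real M) ^ k * EV n"
    using card_grid[where 'n='n, of M 1] by simp
  also have "(\<Sum>T\<in>{T\<in>?\<T>. card T \<ge> 2}. (-1) ^ (1 + card T) * ET (Suc n) T)
      = (\<Sum>T\<in>{T. T \<subseteq> grid M 1 \<and> card T \<ge> 2}. (-1) ^ (card T - 1) * ET (Suc n) T)"
  proof (intro sum.cong)
    fix T :: "('n \<Rightarrow> nat) set" assume "T \<in> {T. T \<subseteq> grid M 1 \<and> card T \<ge> 2}"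
    then obtain m where "card T = Suc m" by (cases "card T") auto
    then show "(-1) ^ (1 + card T) * ET (Suc n) T = (-1) ^ (card T - 1) * ET (Suc n) T" by simp
  qed auto
  finally show ?thesis .
qed

text \<open>Per level, the three factors come from the number of intersecting families, from the
  scaling of \<open>vol\<close>, and from the two coins that must succeed.\<close>

lemma ET_bound:
  assumes T: "T \<subseteq> grid M 1" "card T \<ge> 2"
  obtains C where "C \<ge> 0"
    "\<And>n. \<bar>ET (Suc n) T\<bar> \<le> C * (real M ^ (CARD('n) - 1) * (1 / real M) ^ k * p\<^sup>2) ^ Suc n"
proof -
  have M0: "M > 0" using M by simp
  have finT: "finite T" "T \<noteq> {}" using T(2) finite_subset[OF T(1) finite_grid] by auto
  obtain j j' where j: "j \<in> T" "j' \<in> T" "j \<noteq> j'"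
    using T(2) card_le_Suc0_iff_eq[OF finT(1)] by (metis not_less_eq_eq numeral_2_eq_2)
  obtain C where C: "C \<ge> 0"
    "\<And>n (S :: ('n \<Rightarrow> nat) set). finite S \<Longrightarrow> S \<noteq> {} \<Longrightarrow>
       \<bar>intrinsic_volume_convex k (\<Inter>i\<in>S. grid_cube M n i)\<bar> \<le> C * (1 / real M ^ n) ^ k"
    using intrinsic_volume_INT_grid_cube_bound[OF M0 k] by metis
  let ?B = "2 ^ (3 ^ CARD('n)) :: real"
  show ?thesis
  proof
    show "?B * C \<ge> 0" using C(1) by simp
    fix n
    let ?n = "Suc n"
    let ?\<S> = "{S\<in>Pow (grid M ?n). ancestor M ?n 1 ` S = T}"
    let ?\<S>' = "{S\<in>Pow (grid M ?n). ancestor M ?n 1 ` S = T \<and> (\<Inter>i\<in>S. grid_cube M ?n i) \<noteq> {}}"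
    let ?g = "\<lambda>S. (-1) ^ (card T + card S) * vol ?n S * p ^ card (coins M ?n S)"
    let ?b = "C * (1 / real M ^ ?n) ^ k * p ^ (2 * ?n)"
    \<comment> \<open>Families with empty intersection drop out, since the empty set has intrinsic
      volume \<open>0\<close>.\<close>
    have "\<bar>ET ?n T\<bar> = \<bar>\<Sum>S\<in>?\<S>'. ?g S\<bar>"
    proof -
      have "finite ?\<S>" by (rule finite_subset[of _ "Pow (grid M ?n)"]) (auto simp: finite_grid)
      then have "(\<Sum>S\<in>?\<S>. ?g S) = (\<Sum>S\<in>?\<S>'. ?g S)"
        by (intro sum.mono_neutral_right) (auto simp: vol_def intrinsic_volume_convex_def)
      then show ?thesis by (simp only: ET_eq[OF finT(2,1)])
    qed
    also have "\<dots> \<le> (\<Sum>S\<in>?\<S>'. ?b)"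
    proof (rule order_trans[OF sum_abs sum_mono])
      fix S assume S: "S \<in> ?\<S>'"
      then have "finite S" using finite_grid finite_subset by blast
      have "S \<noteq> {}" using S finT(2) by auto
      have "ancestor M ?n 1 ` S = T" using S by blast
      with j(1,2) have "j \<in> ancestor M ?n 1 ` S" "j' \<in> ancestor M ?n 1 ` S" by simp_all
      then obtain i i' where i: "i \<in> S" "i' \<in> S" "ancestor M ?n 1 i = j" "ancestor M ?n 1 i' = j'"
        by blast
      then have "2 * ?n \<le> card (coins M ?n S)"
        using j(3) by (intro card_coins_ge[OF \<open>finite S\<close> i(1,2)]) auto
      then have "p ^ card (coins M ?n S) \<le> p ^ (2 * ?n)" using p by (intro power_decreasing) auto
      moreover have "\<bar>vol ?n S\<bar> \<le> C * (1 / real M ^ ?n) ^ k"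
        unfolding vol_def by (rule C(2)[OF \<open>finite S\<close> \<open>S \<noteq> {}\<close>])
      ultimately have "\<bar>vol ?n S\<bar> * p ^ card (coins M ?n S) \<le> ?b"
        using p C(1) by (intro mult_mono) auto
      then show "\<bar>?g S\<bar> \<le> ?b" using p by (simp add: abs_mult power_abs)
    qed
    also have "\<dots> = real (card ?\<S>') * ?b" by simp
    also have "\<dots> \<le> real ((M ^ ?n) ^ (CARD('n) - 1) * 2 ^ (3 ^ CARD('n))) * ?b"
      using card_intersecting_families[OF M0 j] C(1) p by (intro mult_right_mono) (simp_all only: of_nat_le_iff, simp)
    also have "\<dots> = (?B * C) * (real M ^ (CARD('n) - 1) * (1 / real M) ^ k * p\<^sup>2) ^ ?n"
    proof -
      have "(1 / real M ^ N) ^ k = ((1 / real M) ^ k) ^ N"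
        "real ((M ^ N) ^ (CARD('n) - 1) * 2 ^ (3 ^ CARD('n))) = (real M ^ (CARD('n) - 1)) ^ N * ?B" for N
        by (simp_all add: power_divide mult.commute flip: power_mult)
      then show ?thesis
        unfolding power_mult[of p 2] by (simp only: power_mult_distrib mult_ac)
    qed
    finally show "\<bar>ET ?n T\<bar> \<le> (?B * C) * (real M ^ (CARD('n) - 1) * (1 / real M) ^ k * p\<^sup>2) ^ ?n" .
  qed
qed

text \<open>At level 0 no coin is tossed, so \<open>fp_step\<close> is the unit cube for every
  outcome. This is the constant term of the limit.\<close>

lemma EV_0: "EV 0 = intrinsic_volume k (cbox (0::real^'n) One)"
proof -
  have "(\<chi> l. 1) = (One :: real^'n)"
  proof (rule euclidean_eqI)
    fix b :: "real^'n" assume b: "b \<in> Basis"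
    then obtain i where "b = axis i 1" by (auto simp: Basis_vec_def)
    then have "(\<chi> l. 1) \<bullet> b = 1" by (simp add: inner_axis)
    then show "(\<chi> l. 1) \<bullet> b = One \<bullet> b" using b by (simp add: inner_sum_left_Basis)
  qed
  then have "grid_cube M 0 (\<lambda>_. 0) = cbox (0::real^'n) One"
    by (simp add: grid_cube_def zero_vec_def)
  moreover have "grid_index M 0 i \<and> fp_survives M X 0 i w \<longleftrightarrow> i = (\<lambda>_. 0)" for i w
    by (auto simp: grid_index_def fp_survives_def)
  ultimately have "fp_step M X 0 w = cbox (0::real^'n) One" for w
    by (simp add: fp_step_def)
  then show ?thesis by (simp add: EV_def prob_space)
qed

section \<open>The limit of the rescaled expectations\<close>

text \<open>\<open>R\<close> is \<open>r powr (D - real k)\<close>, because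
  \<open>real M powr D\<close> equals \<open>real M ^ CARD('n) * p\<close>.\<close>

context
  fixes R :: real
  assumes R: "R = real M ^ k / (real M ^ CARD('n) * p)"
begin

text \<open>Multiplied by \<open>R\<close>, the base in \<open>ET_bound\<close> becomes
  \<open>p / real M\<close>, which is below \<open>1\<close>, so a geometric series
  dominates.\<close>

lemma summable_ET:
  assumes "T \<subseteq> grid M 1" "card T \<ge> 2"
  shows "summable (\<lambda>n. R ^ Suc n * ET (Suc n) T)"
proof -
  obtain C where C: "C \<ge> 0"
    "\<And>n. \<bar>ET (Suc n) T\<bar> \<le> C * (real M ^ (CARD('n) - 1) * (1 / real M) ^ k * p\<^sup>2) ^ Suc n"
    using ET_bound[OF assms] by metis
  have M0: "real M > 0" using M by simp
  have "R > 0" using M0 p by (simp add: R)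
  have "real M ^ CARD('n) = real M * real M ^ (CARD('n) - 1)"
    by (simp add: power_eq_if)
  then have ratio: "R * (real M ^ (CARD('n) - 1) * (1 / real M) ^ k * p\<^sup>2) = p / real M"
    using M0 p by (simp add: R power_divide power2_eq_square)
  have "p / real M < 1" using M p by simp
  show ?thesis
  proof (rule summable_comparison_test')
    show "summable (\<lambda>n. C * (p / real M) * (p / real M) ^ n)"
      using \<open>p / real M < 1\<close> M0 p by (intro summable_mult summable_geometric) simp
    fix n
    have "norm (R ^ Suc n * ET (Suc n) T) = R ^ Suc n * \<bar>ET (Suc n) T\<bar>"
      using \<open>R > 0\<close> by (simp add: abs_mult)
    also have "\<dots> \<le> R ^ Suc n * (C * (real M ^ (CARD('n) - 1) * (1 / real M) ^ k * p\<^sup>2) ^ Suc n)"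
      using \<open>R > 0\<close> C(2) by (intro mult_left_mono) auto
    also have "\<dots> = C * (R * (real M ^ (CARD('n) - 1) * (1 / real M) ^ k * p\<^sup>2)) ^ Suc n"
      by (simp only: power_mult_distrib mult_ac)
    also have "\<dots> = C * (p / real M) * (p / real M) ^ n" unfolding ratio by simp
    finally show "norm (R ^ Suc n * ET (Suc n) T) \<le> C * (p / real M) * (p / real M) ^ n" .
  qed
qed

text \<open>\<open>R\<close> is the reciprocal of the coefficient of \<open>EV n\<close> in
  \<open>EV_Suc\<close>. So the rescaled recursion telescopes to \<open>EV 0\<close> plus partial
  sums of the convergent series.\<close>

lemma scaled_EV_tendsto:
  "(\<lambda>n. R ^ n * EV n) \<longlonglongrightarrow> EV 0
    + (\<Sum>T\<in>{T. T \<subseteq> grid M 1 \<and> card T \<ge> 2}. (-1) ^ (card T - 1) * (\<Sum>n. R ^ Suc n * ET (Suc n) T))"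
proof -
  let ?\<T> = "{T. T \<subseteq> grid M 1 \<and> card T \<ge> 2} :: ('n \<Rightarrow> nat) set set"
  have M0: "real M > 0" using M by simp
  have R1: "R * (real M ^ CARD('n) * p * (1 / real M) ^ k) = 1"
    using M0 p by (simp add: R power_divide)
  have "R ^ n * EV n = EV 0 + (\<Sum>T\<in>?\<T>. (-1) ^ (card T - 1) * (\<Sum>m<n. R ^ Suc m * ET (Suc m) T))" for n
  proof (induction n)
    case (Suc n)
    have "R ^ Suc n * EV (Suc n) = (R * (real M ^ CARD('n) * p * (1 / real M) ^ k)) * (R ^ n * EV n)
        + (\<Sum>T\<in>?\<T>. (-1) ^ (card T - 1) * (R ^ Suc n * ET (Suc n) T))"
      by (simp only: EV_Suc distrib_left sum_distrib_left power_Suc mult_ac)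
    also have "\<dots> = EV 0 + (\<Sum>T\<in>?\<T>. (-1) ^ (card T - 1) * (\<Sum>m<Suc n. R ^ Suc m * ET (Suc m) T))"
      unfolding R1 Suc.IH by (simp add: distrib_left sum.distrib del: power_Suc)
    finally show ?case .
  qed simp
  moreover have "(\<lambda>n. EV 0 + (\<Sum>T\<in>?\<T>. (-1) ^ (card T - 1) * (\<Sum>m<n. R ^ Suc m * ET (Suc m) T)))
    \<longlonglongrightarrow> EV 0 + (\<Sum>T\<in>?\<T>. (-1) ^ (card T - 1) * (\<Sum>n. R ^ Suc n * ET (Suc n) T))"
    using summable_ET by (intro tendsto_intros summable_LIMSEQ) auto
  ultimately show ?thesis by simp
qed

end

end

theorem theorem1p1:
  fixes P :: "'w measure" and X :: "nat \<Rightarrow> ('n::finite \<Rightarrow> nat) \<Rightarrow> 'w \<Rightarrow> bool"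
    and M :: nat and p :: real and k :: nat and D r :: real
  assumes "prob_space P"
    and "M \<ge> 2"
    and "real M powr (- real (min 3 CARD('n))) < p" and "p \<le> 1"
    and "prob_space.indep_vars P (\<lambda>_. count_space UNIV) (\<lambda>(n, i). X n i)
           {(n, i). 1 \<le> n \<and> grid_index M n i}"
    and "\<And>n i. 1 \<le> n \<Longrightarrow> grid_index M n i \<Longrightarrow> measure P {w \<in> space P. X n i w} = p"
    and "k \<le> CARD('n)"
    and "D = ln (real M ^ CARD('n) * p) / ln (real M)"
    and "r = 1 / real M"
  shows "(\<forall>T. T \<subseteq> {j. grid_index M 1 j} \<and> card T \<ge> 2 \<longrightarrow>
           summable (\<lambda>n. r powr (real (Suc n) * (D - real k)) *
             (\<integral>w. intrinsic_volume k (\<Inter>j\<in>T. fp_part M X j (Suc n) w) \<partial>P)))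
       \<and> (\<lambda>n. r powr (real n * (D - real k)) * (\<integral>w. intrinsic_volume k (fp_step M X n w) \<partial>P))
         \<longlonglongrightarrow> intrinsic_volume k (cbox (0::real^'n) One)
             + (\<Sum>T\<in>{T. T \<subseteq> {j. grid_index M 1 j} \<and> card T \<ge> 2}.
                 (-1) ^ (card T - 1) *
                 (\<Sum>n. r powr (real (Suc n) * (D - real k)) *
                    (\<integral>w. intrinsic_volume k (\<Inter>j\<in>T. fp_part M X j (Suc n) w) \<partial>P)))"
proof -
  have p: "p > 0" using assms(3) powr_ge_zero[of "real M"] by (rule le_less_trans[rotated])
  interpret fractal_percolation P X M p k
    using assms p by (simp add: fractal_percolation_def fractal_percolation_axioms_def)
  have M0: "real M > 1" using assms(2) by simp
  define R where "R = real M ^ k / (real M ^ CARD('n) * p)"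
  have "r powr (D - real k) = R"
  proof -
    have "r powr (D - real k) = exp ((real k - D) * ln (real M))"
      using M0 by (simp add: assms(9) powr_def ln_div algebra_simps)
    also have "\<dots> = exp (real k * ln (real M)) / exp (ln (real M ^ CARD('n) * p))"
      using M0 by (simp add: assms(8) left_diff_distrib exp_diff)
    also have "\<dots> = R" using M0 p by (simp add: R_def exp_of_nat_mult)
    finally show ?thesis .
  qed
  moreover have "r > 0" using M0 by (simp add: assms(9))
  \<comment> \<open>The real powers in the claim become integer powers of \<open>R\<close>, the form
    used in the recursion.\<close>
  ultimately have R: "r powr (real n * (D - real k)) = R ^ n" for n
    by (metis mult.commute powr_gt_zero powr_powr powr_realpow less_irrefl)
  show ?thesis
    unfolding R
  proof (intro conjI allI impI)
    fix T :: "('n \<Rightarrow> nat) set" assume "T \<subseteq> grid M 1 \<and> card T \<ge> 2"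
    then show "summable (\<lambda>n. R ^ Suc n * (\<integral>w. intrinsic_volume k (\<Inter>j\<in>T. fp_part M X j (Suc n) w) \<partial>P))"
      using summable_ET[OF R_def, of T] unfolding ET_def by blast
  qed (rule scaled_EV_tendsto[OF R_def, unfolded EV_0, unfolded EV_def ET_def])
qed

end
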